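(* Let $\mathbf{V}$ be a (real) vector space, $\mathbf{E}\subseteq\mathbf{V}$ a subspace equipped with a norm $\|\cdot\|_{\mathbf{E}}$ (not necessarily separable), and $\mathcal{B}^\circ$ the open-ball $\sigma$-algebra on $\mathbf{E}$. Let $(\widetilde{\mathbf{E}},\|\cdot\|_{\widetilde{\mathbf{E}}})$ be a separable normed vector space with Borel $\sigma$-algebra $\widetilde{\mathcal{B}}$. Let $(\Omega,\mathcal{F},\mathbb{P})$ and $(\Omega',\mathcal{F}',\mathbb{P}')$ be probability spaces and $(\overline\Omega,\overline{\mathcal{F}},\overline{\mathbb{P}}):=(\Omega\times\Omega',\mathcal{F}\otimes\mathcal{F}',\mathbb{P}\otimes\mathbb{P}')$. Let $f:\mathbf{V}_f\to\widetilde{\mathbf{E}}$ be a map defined on a subset $\mathbf{V}_f\subseteq\mathbf{V}$, and for every $n\in\mathbb{N}$ let $\widehat T_n:\Omega\to\mathbf{V}$ and $\widehat T_n^*:\overline\Omega\to\mathbf{V}$ be maps taking values only in $\mathbf{V}_f$ ($\widehat T_n$ is also regarded as a map on $\overline\Omega$ via $\widehat T_n(\omega,\omega'):=\widehat T_n(\omega)$). Let $\theta\in\mathbf{V}_f$, let $\mathbf{E}_0\subseteq\mathbf{E}$ be a separable subspace with $\mathbf{E}_0\in\mathcal{B}^\circ$, and let $(a_n)$ be a sequence of positive real numbers tending to $\infty$. Consider the following conditions (measurability and range requirements are for every $n\in\mathbb{N}$): (a) $a_n(\widehat T_n-\theta)$ takes values only in $\mathbf{E}$, is $(\mathcal{F},\mathcal{B}^\circ)$-measurable,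 and $a_n(\widehat T_n-\theta)\leadsto^\circ\xi$ in $(\mathbf{E},\mathcal{B}^\circ,\|\cdot\|_{\mathbf{E}})$ for some $(\mathbf{E},\mathcal{B}^\circ)$-valued random variable $\xi$ on some probability space $(\Omega_0,\mathcal{F}_0,\mathbb{P}_0)$ with $\xi(\Omega_0)\subseteq\mathbf{E}_0$. (b) $f(\widehat T_n):\Omega\to\widetilde{\mathbf{E}}$ is $(\mathcal{F},\widetilde{\mathcal{B}})$-measurable. (c) $f$ is quasi-Hadamard differentiable at $\theta$ tangentially to $\mathbf{E}_0\langle\mathbf{E}\rangle$ with quasi-Hadamard derivative $\dot f_\theta$. (d) $\dot f_\theta$ can be extended from $\mathbf{E}_0$ to $\mathbf{E}$ such that the extension $\dot f_\theta:\mathbf{E}\to\widetilde{\mathbf{E}}$ is linear, $(\mathcal{B}^\circ,\widetilde{\mathcal{B}})$-measurable, and continuous at every point of $\mathbf{E}_0$. (e) $f(\widehat T_n^* ):\overline\Omega\to\widetilde{\mathbf{E}}$ is $(\overline{\mathcal{F}},\widetilde{\mathcal{B}})$-measurable. (f) $a_n(\widehat T_n^*-\theta)$ and $a_n(\widehat T_n^*-\widehat T_n)$ take values only in $\mathbf{E}$ and are $(\overline{\mathcal{F}},\mathcal{B}^\circ)$-measurable, and for $\mathbb{P}$-a.e. $\omega$ $$a_n(\widehat T_n^*(\omega,\cdot)-\widehat T_n(\omega))\leadsto^\circ\xi\quad\text{in }(\mathbf{E},\mathcal{B}^\circ,\|\cdot\|_{\mathbf{E}}),$$ where the left-hand side is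 regarded as a random variable on $(\Omega',\mathcal{F}',\mathbb{P}')$. (f') $a_n(\widehat T_n^*-\theta)$ and $a_n(\widehat T_n^*-\widehat T_n)$ take values only in $\mathbf{E}$ and are $(\overline{\mathcal{F}},\mathcal{B}^\circ)$-measurable, and with $P_n(\omega,\cdot):=\mathbb{P}'\circ\{a_n(\widehat T_n^*(\omega,\cdot)-\widehat T_n(\omega))\}^{-1}$ (a probability measure on $(\mathbf{E},\mathcal{B}^\circ)$), $$\lim_{n\to\infty}\mathbb{P}^{\mathsf{out}}\big[\{\omega\in\Omega: d_{\rm BL}^\circ(P_n(\omega,\cdot),\mathrm{law}\{\xi\})\ge\delta\}\big]=0\quad\text{for all }\delta>0.$$ Then the following assertions hold: (i) If (a)--(c) hold, then $a_n(f(\widehat T_n)-f(\theta))$ and $\dot f_\theta(\xi)$ are respectively $(\mathcal{F},\widetilde{\mathcal{B}})$- and $(\mathcal{F}_0,\widetilde{\mathcal{B}})$-measurable, and $a_n(f(\widehat T_n)-f(\theta))\leadsto\dot f_\theta(\xi)$ in $(\widetilde{\mathbf{E}},\widetilde{\mathcal{B}},\|\cdot\|_{\widetilde{\mathbf{E}}})$. (ii) If (a)--(f) hold (i.e. (a), (b), (c), (d), (e), (f)), then $a_n(f(\widehat T_n^* )-f(\widehat T_n))$ and $\dot f_\theta(\xi)$ are respectively $(\overline{\mathcal{F}},\widetilde{\mathcal{B}})$- and $(\mathcal{F}_0,\widetilde{\mathcal{B}})$-measurable, and with $\widetilde P_n(\omega,\cdot):=\mathbb{P}'\circ\{a_n(f(\widehat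 T_n^*(\omega,\cdot))-f(\widehat T_n(\omega)))\}^{-1}$, $$\lim_{n\to\infty}\mathbb{P}\big[\{\omega\in\Omega:\widetilde d_{\rm BL}(\widetilde P_n(\omega,\cdot),\mathrm{law}\{\dot f_\theta(\xi)\})\ge\delta\}\big]=0\quad\text{for all }\delta>0.$$ (iii) Assertion (ii) still holds when (f) is replaced by (f').
   Context: Open-ball $\sigma$-algebra and convergence in distribution$^\circ$: for a metric space $(\mathbf{E},d)$, $\mathcal{B}^\circ$ is the $\sigma$-algebra generated by the open balls (it equals the Borel $\sigma$-algebra if $(\mathbf E,d)$ is separable). $C_b^\circ$ is the set of bounded, continuous, $(\mathcal{B}^\circ,\mathcal{B}(\mathbb{R}))$-measurable functions $\mathbf{E}\to\mathbb{R}$. For probability measures on $(\mathbf{E},\mathcal{B}^\circ)$, $\mu_n\Rightarrow^\circ\mu_0$ means $\int g\,d\mu_n\to\int g\,d\mu_0$ for all $g\in C_b^\circ$. For $(\mathbf{E},\mathcal{B}^\circ)$-valued random variables (possibly on different probability spaces), $X_n\leadsto^\circ X_0$ means $\mathrm{law}\{X_n\}\Rightarrow^\circ\mathrm{law}\{X_0\}$. In the separable case this is ordinary convergence in distribution, written $\leadsto$. Bounded Lipschitz distance: $\mathrm{BL}_1^\circ$ is the set of $(\mathcal{B}^\circ,\mathcal{B}(\mathbb{R}))$-measurable $g:\mathbf{E}\to\mathbb{R}$ with $|g(x)-g(y)|\le d(x,y)$ for all $x,y$ and $\sup|g|\le1$; $d_{\rm BL}^\circ(\mu,\nu):=\sup_{g\in\mathrm{BL}_1^\circ}|\int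 g\,d\mu-\int g\,d\nu|$. $\widetilde d_{\rm BL}$ is the same object for $(\widetilde{\mathbf{E}},\widetilde{\mathcal{B}})$ (with $\widetilde{\mathbf E}$ separable). Outer probability: $\mathbb{P}^{\mathsf{out}}[S]:=\inf\{\mathbb{P}[\overline S]:\overline S\in\mathcal{F},\ \overline S\supseteq S\}$ for $S\subseteq\Omega$. Quasi-Hadamard differentiability: let $H:\mathbf{V}_H\to\widetilde{\mathbf{E}}$ with $\mathbf{V}_H\subseteq\mathbf{V}$, and $\mathbf{E}_0\subseteq\mathbf{E}$. $H$ is quasi-Hadamard differentiable at $x\in\mathbf{V}_H$ tangentially to $\mathbf{E}_0\langle\mathbf{E}\rangle$ if there is a continuous map $\dot H_x:\mathbf{E}_0\to\widetilde{\mathbf{E}}$ (the quasi-Hadamard derivative) such that $\lim_{n\to\infty}\|\dot H_x(x_0)-\varepsilon_n^{-1}(H(x+\varepsilon_nx_n)-H(x))\|_{\widetilde{\mathbf{E}}}=0$ for each triplet $(x_0,(x_n),(\varepsilon_n))$ with $x_0\in\mathbf{E}_0$, $(x_n)\subseteq\mathbf{E}$, $\|x_n-x_0\|_{\mathbf{E}}\to0$, $(x+\varepsilon_nx_n)\subseteq\mathbf{V}_H$, $(\varepsilon_n)\subset(0,\infty)$, $\varepsilon_n\to0$. *)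

theory Defs
  imports "HOL-Probability.Probability"
begin

section \<open>Normed subspaces of a vector space\<close>

text \<open>The ambient space is a bare real vector space; the norm lives only on the linear subspace
  \<open>E\<close>, so the values of \<open>nE\<close> outside \<open>E\<close> are irrelevant.\<close>

definition normed_subspace :: "'v::real_vector set \<Rightarrow> ('v \<Rightarrow> real) \<Rightarrow> bool" where
  "normed_subspace E nE \<longleftrightarrow>
     subspace E \<and>
     (\<forall>x\<in>E. 0 \<le> nE x) \<and>
     (\<forall>x\<in>E. nE x = 0 \<longleftrightarrow> x = 0) \<and>
     (\<forall>x\<in>E. \<forall>c. nE (c *\<^sub>R x) = \<bar>c\<bar> * nE x) \<and>
     (\<forall>x\<in>E. \<forall>y\<in>E. nE (x + y) \<le> nE x + nE y)"

text \<open>\<^const>\<open>Metric_space\<close> demands nonnegativity and symmetry on the whole type, hence the cut-off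
  outside \<open>E\<close>.\<close>

definition norm_metric :: "'v::real_vector set \<Rightarrow> ('v \<Rightarrow> real) \<Rightarrow> 'v metric" where
  "norm_metric E nE = metric (E, \<lambda>x y. if x \<in> E \<and> y \<in> E then nE (x - y) else 0)"

lemma normed_subspace_Metric_space:
  assumes "normed_subspace E nE"
  shows "Metric_space E (\<lambda>x y. if x \<in> E \<and> y \<in> E then nE (x - y) else 0)"
proof
  have sub: "subspace E"
    and nonneg: "\<And>x. x \<in> E \<Longrightarrow> 0 \<le> nE x"
    and zero: "\<And>x. x \<in> E \<Longrightarrow> nE x = 0 \<longleftrightarrow> x = 0"
    and scale: "\<And>x c. x \<in> E \<Longrightarrow> nE (c *\<^sub>R x) = \<bar>c\<bar> * nE x"
    and tri: "\<And>x y. x \<in> E \<Longrightarrow> y \<in> E \<Longrightarrow> nE (x + y) \<le> nE x + nE y"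
    using assms unfolding normed_subspace_def by simp_all
  have diff: "\<And>x y. x \<in> E \<Longrightarrow> y \<in> E \<Longrightarrow> x - y \<in> E"
    using sub by (rule subspace_diff)
  show "0 \<le> (if x \<in> E \<and> y \<in> E then nE (x - y) else 0)" for x y
    using nonneg[OF diff, of x y] by simp
  show "(if x \<in> E \<and> y \<in> E then nE (x - y) else 0) = (if y \<in> E \<and> x \<in> E then nE (y - x) else 0)"
    for x y
    using scale[OF diff, of x y "-1"] by simp
  show "(if x \<in> E \<and> y \<in> E then nE (x - y) else 0) = 0 \<longleftrightarrow> x = y" if "x \<in> E" "y \<in> E" for x y
    using zero[OF diff[OF that]] that by simp
  show "(if x \<in> E \<and> z \<in> E then nE (x - z) else 0)
      \<le> (if x \<in> E \<and> y \<in> E then nE (x - y) else 0) + (if y \<in> E \<and> z \<in> E then nE (y - z) else 0)"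
    if "x \<in> E" "y \<in> E" "z \<in> E" for x y z
    using tri[OF diff[of x y] diff[of y z]] that by simp
qed

lemma mspace_norm_metric: "normed_subspace E nE \<Longrightarrow> mspace (norm_metric E nE) = E"
  unfolding norm_metric_def
  by (rule Metric_space.mspace_metric) (rule normed_subspace_Metric_space)

lemma mdist_norm_metric:
  assumes "normed_subspace E nE" "x \<in> E" "y \<in> E"
  shows "mdist (norm_metric E nE) x y = nE (x - y)"
  using Metric_space.mdist_metric[OF normed_subspace_Metric_space[OF assms(1)]] assms(2,3)
  by (simp add: norm_metric_def)


section \<open>Open-ball sigma-algebra and convergence in distribution\<close>

definition ball_algebra :: "'a metric \<Rightarrow> 'a measure" where
  "ball_algebra m = sigma (mspace m) {mball_of m x r |x r. x \<in> mspace m}"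

lemma ball_generators_subset: "{mball_of m x r |x r. x \<in> mspace m} \<subseteq> Pow (mspace m)"
  by auto

lemma space_ball_algebra: "space (ball_algebra m) = mspace m"
  unfolding ball_algebra_def by (rule space_measure_of[OF ball_generators_subset])

lemma ball_algebra_euclidean:
  "ball_algebra (euclidean_metric :: 'a::{metric_space, second_countable_topology} metric) = borel"
proof -
  define G :: "'a set set" where "G = {ball x r |x r. True}"
  have balls: "{mball_of euclidean_metric x r |x r. x \<in> mspace euclidean_metric} = G"
    unfolding G_def mball_of_def by simp
  have ball_G: "ball x r \<in> sigma_sets UNIV G" for x r
    unfolding G_def by (rule sigma_sets.Basic) blast
  have "sigma_sets UNIV (Collect open) = sigma_sets UNIV G"
  proof (rule sigma_sets_eqI)
    fix U :: "'a set"
    assume "U \<in> Collect open"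
    then have U: "open U" by simp
    define F where "F = {ball x r |x r. ball x r \<subseteq> U}"
    have op: "\<And>S. S \<in> F \<Longrightarrow> open S" unfolding F_def by blast
    obtain F' where F': "F' \<subseteq> F" "countable F'" "\<Union>F' = \<Union>F"
      using Lindelof[OF op] by metis
    have "U \<subseteq> \<Union>F"
    proof
      fix x assume "x \<in> U"
      then obtain e where e: "e > 0" "ball x e \<subseteq> U" using U open_contains_ball by blast
      then have "ball x e \<in> F" unfolding F_def by blast
      moreover have "x \<in> ball x e" using e by simp
      ultimately show "x \<in> \<Union>F" by blast
    qed
    moreover have "\<Union>F \<subseteq> U" unfolding F_def by blast
    ultimately have "U = \<Union>F'" using F'(3) by blast
    moreover have "\<Union>F' \<in> sigma_sets UNIV G"
    proof (rule sigma_sets_UNION[OF F'(2)])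
      fix S assume "S \<in> F'"
      then have "S \<in> F" using F'(1) by blast
      then show "S \<in> sigma_sets UNIV G" unfolding F_def using ball_G by blast
    qed
    ultimately show "U \<in> sigma_sets UNIV G" by simp
  next
    fix S assume "S \<in> G"
    then have "open S" unfolding G_def by blast
    then show "S \<in> sigma_sets UNIV (Collect open)" by (intro sigma_sets.Basic) simp
  qed
  then have "sigma UNIV (Collect open) = sigma UNIV G"
    by (intro sigma_eqI) auto
  then show ?thesis
    unfolding ball_algebra_def balls by (simp add: borel_def)
qed

definition Cb_ball :: "'a metric \<Rightarrow> ('a \<Rightarrow> real) set" where
  "Cb_ball m = {g. (\<exists>B. \<forall>x\<in>mspace m. \<bar>g x\<bar> \<le> B) \<and>
                   continuous_map (mtopology_of m) euclideanreal g \<and>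
                   g \<in> measurable (ball_algebra m) borel}"

definition weak_conv_ball :: "'a metric \<Rightarrow> (nat \<Rightarrow> 'a measure) \<Rightarrow> 'a measure \<Rightarrow> bool" where
  "weak_conv_ball m \<mu> \<mu>0 \<longleftrightarrow>
     (\<forall>g\<in>Cb_ball m. (\<lambda>n. \<integral>x. g x \<partial>\<mu> n) \<longlonglongrightarrow> (\<integral>x. g x \<partial>\<mu>0))"

text \<open>Only meaningful for \<open>X n\<close>, \<open>X0\<close> measurable into \<^term>\<open>ball_algebra m\<close>.  For
  \<^term>\<open>euclidean_metric\<close> on a separable space this is ordinary convergence in distribution, by
  \<open>ball_algebra_euclidean\<close>.\<close>

definition conv_in_distr_ball ::
  "'a metric \<Rightarrow> (nat \<Rightarrow> 'w measure) \<Rightarrow> (nat \<Rightarrow> 'w \<Rightarrow> 'a) \<Rightarrow> 'z measure \<Rightarrow> ('z \<Rightarrow> 'a) \<Rightarrow> bool" where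
  "conv_in_distr_ball m M X M0 X0 \<longleftrightarrow>
     weak_conv_ball m (\<lambda>n. distr (M n) (ball_algebra m) (X n)) (distr M0 (ball_algebra m) X0)"

definition BL1_ball :: "'a metric \<Rightarrow> ('a \<Rightarrow> real) set" where
  "BL1_ball m = {g. g \<in> measurable (ball_algebra m) borel \<and>
                    (\<forall>x\<in>mspace m. \<forall>y\<in>mspace m. \<bar>g x - g y\<bar> \<le> mdist m x y) \<and>
                    (\<forall>x\<in>mspace m. \<bar>g x\<bar> \<le> 1)}"

definition dist_BL_ball :: "'a metric \<Rightarrow> 'a measure \<Rightarrow> 'a measure \<Rightarrow> real" where
  "dist_BL_ball m \<mu> \<nu> = (SUP g\<in>BL1_ball m. \<bar>(\<integral>x. g x \<partial>\<mu>) - (\<integral>x. g x \<partial>\<nu>)\<bar>)"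

definition outer_prob :: "'w measure \<Rightarrow> 'w set \<Rightarrow> real" where
  "outer_prob P S = (INF A\<in>{A \<in> sets P. S \<subseteq> A}. measure P A)"


section \<open>Quasi-Hadamard differentiability\<close>

text \<open>\<open>D\<close> is the derivative, a map on \<open>E0\<close>; its values outside \<open>E0\<close> play no role.\<close>

definition has_quasi_hadamard_derivative ::
  "('v::real_vector \<Rightarrow> 'e::real_normed_vector) \<Rightarrow> 'v set \<Rightarrow> 'v set \<Rightarrow> ('v \<Rightarrow> real) \<Rightarrow> 'v set
     \<Rightarrow> 'v \<Rightarrow> ('v \<Rightarrow> 'e) \<Rightarrow> bool" where
  "has_quasi_hadamard_derivative H VH E nE E0 x D \<longleftrightarrow>
     continuous_map (subtopology (mtopology_of (norm_metric E nE)) E0) euclidean D \<and>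
     (\<forall>x0 xs \<epsilon>. x0 \<in> E0 \<and> (\<forall>n. xs n \<in> E) \<and> (\<lambda>n. nE (xs n - x0)) \<longlonglongrightarrow> 0 \<and>
        (\<forall>n. x + \<epsilon> n *\<^sub>R xs n \<in> VH) \<and> (\<forall>n. 0 < \<epsilon> n) \<and> \<epsilon> \<longlonglongrightarrow> 0 \<longrightarrow>
        (\<lambda>n::nat. norm (D x0 - inverse (\<epsilon> n) *\<^sub>R (H (x + \<epsilon> n *\<^sub>R xs n) - H x))) \<longlonglongrightarrow> 0)"

end

theory Submission
  imports Defs
begin

text \<open>Put \<open>X\<^sub>n = a\<^sub>n (T\<^sub>n - \<theta>)\<close>, \<open>Z\<^sub>n = a\<^sub>n (Ts\<^sub>n - T\<^sub>n)\<close> and \<open>h\<^sub>n x = a\<^sub>n (f (\<theta> + x / a\<^sub>n) - f \<theta>)\<close>, so that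
  \<open>a\<^sub>n (f Ts\<^sub>n - f T\<^sub>n) = h\<^sub>n (X\<^sub>n + Z\<^sub>n) - h\<^sub>n X\<^sub>n\<close>. Quasi-Hadamard differentiability and additivity of the
  derivative on \<open>E0\<close> say that this is close to \<open>D z\<close> whenever \<open>n\<close> is large, \<open>X\<^sub>n\<close> is near some
  \<open>y \<in> E0\<close> and \<open>Z\<^sub>n\<close> is near \<open>z \<in> E0\<close>. By separability of \<open>E0\<close>, finitely many such pairs of balls carry
  almost all of the mass of two independent copies of \<open>\<xi>\<close>. A partition of unity subordinate to them,
  built from sums of products of Lipschitz functions of the distance to a point (hence measurable
  for the open-ball algebra), bounds the bounded Lipschitz distance by the errors of finitely many
  conditional means. Those errors are measurable and tend to \<open>0\<close> in mean under either mode of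
  bootstrap convergence, and Markov's inequality concludes.\<close>

section \<open>Bounded Lipschitz functions\<close>

text \<open>Two obstacles shape the argument. Without separability, addition need not be measurable
  from the product of two open-ball algebras to the open-ball algebra, and a Lipschitz function of a
  pair need not be measurable for that product, so a mapping theorem on the product space is not at
  hand. Test functions of the pair are therefore finite sums of \<open>A x * B z\<close>: they are
  jointly measurable, and for fixed \<open>\<omega>\<close> the factor \<open>A (X\<^sub>n)\<close>
  leaves the inner integral, so that only the conditional mean of \<open>B (Z\<^sub>n)\<close> has
  to converge. Moreover \<open>X\<^sub>n\<close> converges in law only. For a fixed
  \<open>\<omega>\<close> its values may wander, so the conditional laws cannot be compared
  pointwise in \<open>\<omega>\<close>; the part of the pair outside the finite cover is small only
  after averaging over \<open>\<omega>\<close>. Uniformity over the test functions comes for free: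
  such a function enters only through its values at the images of finitely many centres, and these
  are bounded by 1.\<close>

definition bl_functions :: "'a metric \<Rightarrow> ('a \<Rightarrow> real) set" where
  "bl_functions m = {g. g \<in> borel_measurable (ball_algebra m) \<and>
     (\<exists>C. \<forall>x\<in>mspace m. \<bar>g x\<bar> \<le> C \<and> (\<forall>y\<in>mspace m. \<bar>g x - g y\<bar> \<le> C * mdist m x y))}"

lemma bl_functions_measurable: "g \<in> bl_functions m \<Longrightarrow> g \<in> borel_measurable (ball_algebra m)"
  by (simp add: bl_functions_def)

lemma bl_functionsE:
  assumes "g \<in> bl_functions m"
  obtains C where "0 < C" "\<And>x. x \<in> mspace m \<Longrightarrow> \<bar>g x\<bar> \<le> C"
    "\<And>x y. x \<in> mspace m \<Longrightarrow> y \<in> mspace m \<Longrightarrow> \<bar>g x - g y\<bar> \<le> C * mdist m x y"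
proof -
  obtain C where C: "\<And>x. x \<in> mspace m \<Longrightarrow> \<bar>g x\<bar> \<le> C"
    "\<And>x y. x \<in> mspace m \<Longrightarrow> y \<in> mspace m \<Longrightarrow> \<bar>g x - g y\<bar> \<le> C * mdist m x y"
    using assms unfolding bl_functions_def by blast
  show thesis
  \<comment> \<open>Raising the constant makes it positive, so that division by it can later
    normalise \<open>g\<close>.\<close>
  proof (rule that[of "max C 1"])
    show "\<bar>g x\<bar> \<le> max C 1" if "x \<in> mspace m" for x
      using C(1)[OF that] by simp
    show "\<bar>g x - g y\<bar> \<le> max C 1 * mdist m x y" if "x \<in> mspace m" "y \<in> mspace m" for x y
    proof -
      have "C * mdist m x y \<le> max C 1 * mdist m x y"
        by (rule mult_right_mono) (simp_all add: mdist_nonneg)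
      then show ?thesis
        using C(2)[OF that] by linarith
    qed
  qed simp
qed

lemma bl_functions_const: "(\<lambda>x. c) \<in> bl_functions m"
  by (auto simp: bl_functions_def intro!: exI[of _ "\<bar>c\<bar>"])

text \<open>The product rule gives the Lipschitz constant \<open>2 * C * K\<close>. The sharper
  bound \<open>C * K\<close> on the values is relaxed to it, since one constant has to serve for
  both properties.\<close>

lemma bl_functions_mult:
  assumes "f \<in> bl_functions m" "g \<in> bl_functions m"
  shows "(\<lambda>x. f x * g x) \<in> bl_functions m"
proof -
  obtain C where C: "0 < C" "\<And>x. x \<in> mspace m \<Longrightarrow> \<bar>f x\<bar> \<le> C"
    "\<And>x y. x \<in> mspace m \<Longrightarrow> y \<in> mspace m \<Longrightarrow> \<bar>f x - f y\<bar> \<le> C * mdist m x y"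
    using bl_functionsE[OF assms(1)] by blast
  obtain K where K: "0 < K" "\<And>x. x \<in> mspace m \<Longrightarrow> \<bar>g x\<bar> \<le> K"
    "\<And>x y. x \<in> mspace m \<Longrightarrow> y \<in> mspace m \<Longrightarrow> \<bar>g x - g y\<bar> \<le> K * mdist m x y"
    using bl_functionsE[OF assms(2)] by blast
  have "\<bar>f x * g x\<bar> \<le> 2 * C * K" if "x \<in> mspace m" for x
  proof -
    have "\<bar>f x\<bar> * \<bar>g x\<bar> \<le> C * K"
      using C(1) C(2)[OF that] K(2)[OF that] by (intro mult_mono) auto
    moreover have "0 < C * K" using C(1) K(1) by simp
    ultimately show ?thesis by (simp add: abs_mult)
  qed
  moreover have "\<bar>f x * g x - f y * g y\<bar> \<le> 2 * C * K * mdist m x y"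
    if "x \<in> mspace m" "y \<in> mspace m" for x y
  proof -
    have "f x * g x - f y * g y = f x * (g x - g y) + (f x - f y) * g y"
      by (simp add: algebra_simps)
    then have "\<bar>f x * g x - f y * g y\<bar> \<le> \<bar>f x\<bar> * \<bar>g x - g y\<bar> + \<bar>f x - f y\<bar> * \<bar>g y\<bar>"
      by (metis abs_mult abs_triangle_ineq)
    also have "\<dots> \<le> C * (K * mdist m x y) + (C * mdist m x y) * K"
      using C(1) C(2)[OF that(1)] K(2)[OF that(2)] C(3)[OF that] K(3)[OF that]
      by (intro add_mono mult_mono) (auto simp: mdist_nonneg)
    finally show ?thesis by (simp add: algebra_simps)
  qed
  moreover have "(\<lambda>x. f x * g x) \<in> borel_measurable (ball_algebra m)"
    using assms[THEN bl_functions_measurable] by measurable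
  ultimately show ?thesis unfolding bl_functions_def by blast
qed

section \<open>Distance functions and bumps measurable for the open-ball algebra\<close>

lemma mball_in_ball_algebra: "x \<in> mspace m \<Longrightarrow> mball_of m x r \<in> sets (ball_algebra m)"
  unfolding ball_algebra_def sets_measure_of[OF ball_generators_subset]
  by (rule sigma_sets.Basic) blast

text \<open>The strict sublevel sets of the distance to a point are exactly the generating balls.
  This is the only source of measurable functions on the nonseparable space.\<close>

lemma mdist_measurable:
  assumes "x \<in> mspace m"
  shows "mdist m x \<in> borel_measurable (ball_algebra m)"
  unfolding borel_measurable_iff_less
proof
  fix r
  have "{w \<in> space (ball_algebra m). mdist m x w < r} = mball_of m x r"
    using assms by (auto simp: space_ball_algebra)
  then show "{w \<in> space (ball_algebra m). mdist m x w < r} \<in> sets (ball_algebra m)"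
    using mball_in_ball_algebra[OF assms] by simp
qed

text \<open>A trapezoid of slope \<open>1/r\<close> in the distance to \<open>y\<close>: the plateau
  reaches to radius \<open>r\<close> and the support ends at \<open>2 * r\<close>. The plateau makes
  a factor \<open>1 - bump\<close> vanish exactly, and the support localises each piece of the
  partition of unity.\<close>

definition bump :: "'a metric \<Rightarrow> 'a \<Rightarrow> real \<Rightarrow> 'a \<Rightarrow> real" where
  "bump m y r x = max 0 (min 1 (2 - mdist m y x / r))"

lemma bump_nonneg: "0 \<le> bump m y r x"
  and bump_le_1: "bump m y r x \<le> 1"
  by (auto simp: bump_def)

lemma bump_eq_1: "0 < r \<Longrightarrow> mdist m y x < r \<Longrightarrow> bump m y r x = 1"
  by (simp add: bump_def)

lemma bump_pos_imp: "0 < r \<Longrightarrow> 0 < bump m y r x \<Longrightarrow> mdist m y x < 2 * r"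
  by (auto simp: bump_def max_def min_def field_simps split: if_splits)

text \<open>Clamping to the unit interval is nonexpansive, so the slope \<open>1/r\<close> of the
  profile is the Lipschitz constant; the maximum with 1 covers the bound on the values.\<close>

lemma bump_bl_functions:
  assumes y: "y \<in> mspace m" and r: "0 < r"
  shows "bump m y r \<in> bl_functions m"
proof -
  have "\<bar>bump m y r x - bump m y r z\<bar> \<le> max 1 (1/r) * mdist m x z"
    if "x \<in> mspace m" "z \<in> mspace m" for x z
  proof -
    have "\<bar>mdist m y x - mdist m y z\<bar> \<le> mdist m x z"
      using mdist_triangle[OF y that] mdist_triangle[OF y that(2) that(1)] mdist_commute[of m x z]
      by linarith
    then have "\<bar>mdist m y x / r - mdist m y z / r\<bar> \<le> mdist m x z / r"
      using r by (simp add: diff_divide_distrib[symmetric] divide_right_mono)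
    then have "\<bar>bump m y r x - bump m y r z\<bar> \<le> 1/r * mdist m x z"
      unfolding bump_def by (auto simp: max_def min_def)
    also have "\<dots> \<le> max 1 (1/r) * mdist m x z"
      by (rule mult_right_mono) (auto simp: mdist_nonneg)
    finally show ?thesis .
  qed
  moreover have "bump m y r \<in> borel_measurable (ball_algebra m)"
    using mdist_measurable[OF y] unfolding bump_def[abs_def] by measurable
  moreover have "\<bar>bump m y r x\<bar> \<le> max 1 (1/r)" for x
    using bump_nonneg[of m y r x] bump_le_1[of m y r x] by linarith
  ultimately show ?thesis unfolding bl_functions_def by blast
qed

text \<open>Through this inclusion weak convergence yields convergence of the means of every bounded
  Lipschitz test function.\<close>

lemma bl_functions_subset_Cb: "bl_functions m \<subseteq> Cb_ball m"
proof
  fix g assume g: "g \<in> bl_functions m"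
  obtain C where C: "0 < C" "\<And>x. x \<in> mspace m \<Longrightarrow> \<bar>g x\<bar> \<le> C"
    "\<And>x y. x \<in> mspace m \<Longrightarrow> y \<in> mspace m \<Longrightarrow> \<bar>g x - g y\<bar> \<le> C * mdist m x y"
    using bl_functionsE[OF g] by blast
  have "Lipschitz_continuous_map m euclidean_metric g"
    unfolding Lipschitz_continuous_map_def using C(3) by (auto simp: dist_real_def)
  then have "continuous_map (mtopology_of m) euclideanreal g"
    using Lipschitz_continuous_imp_continuous_map by force
  then show "g \<in> Cb_ball m"
    unfolding Cb_ball_def using C(2) bl_functions_measurable[OF g] by blast
qed

text \<open>The algebraic tensor product of the test functions with themselves; scalars are absorbed
  in one factor. A general Lipschitz function of the pair, such as the distance of its two
  arguments, need not be measurable for the product of the open-ball algebras.\<close>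

inductive_set bl_tensor :: "'a metric \<Rightarrow> ('a \<Rightarrow> 'a \<Rightarrow> real) set" for m where
  product: "A \<in> bl_functions m \<Longrightarrow> B \<in> bl_functions m \<Longrightarrow> (\<lambda>x z. A x * B z) \<in> bl_tensor m"
| add: "\<Phi> \<in> bl_tensor m \<Longrightarrow> \<Psi> \<in> bl_tensor m \<Longrightarrow> (\<lambda>x z. \<Phi> x z + \<Psi> x z) \<in> bl_tensor m"

lemma bl_tensor_const: "(\<lambda>x z. c) \<in> bl_tensor m"
  using bl_tensor.product[OF bl_functions_const[of c] bl_functions_const[of 1]] by simp

text \<open>Double induction: two elementary products regroup factor by factor, and sums distribute.
  This closure admits the products of complements from which the partition of unity is
  built.\<close>

lemma bl_tensor_mult:
  assumes "\<Phi> \<in> bl_tensor m" "\<Psi> \<in> bl_tensor m"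
  shows "(\<lambda>x z. \<Phi> x z * \<Psi> x z) \<in> bl_tensor m"
  using assms(1)
proof (induction \<Phi>)
  case (product A B)
  show ?case using assms(2)
  proof (induction \<Psi>)
    case (product A' B')
    then have "(\<lambda>x z. (A x * A' x) * (B z * B' z)) \<in> bl_tensor m"
      using \<open>A \<in> bl_functions m\<close> \<open>B \<in> bl_functions m\<close>
      by (intro bl_tensor.product bl_functions_mult)
    then show ?case by (simp add: ac_simps)
  next
    case (add \<Phi> \<Psi>)
    then show ?case using bl_tensor.add by (fastforce simp: distrib_left)
  qed
next
  case (add \<Phi> \<Phi>')
  then show ?case using bl_tensor.add by (fastforce simp: distrib_right)
qed

lemma bl_tensor_diff:
  assumes "\<Phi> \<in> bl_tensor m" "\<Psi> \<in> bl_tensor m"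
  shows "(\<lambda>x z. \<Phi> x z - \<Psi> x z) \<in> bl_tensor m"
  using bl_tensor.add[OF assms(1) bl_tensor_mult[OF bl_tensor_const[of "-1"] assms(2)]] by simp

lemma bl_tensor_prod:
  assumes "\<And>i. i < (k::nat) \<Longrightarrow> \<Phi> i \<in> bl_tensor m"
  shows "(\<lambda>x z. \<Prod>i<k. \<Phi> i x z) \<in> bl_tensor m"
  using assms
proof (induction k)
  case 0
  then show ?case using bl_tensor_const by simp
next
  case (Suc k)
  then show ?case using bl_tensor_mult[of "\<lambda>x z. \<Prod>i<k. \<Phi> i x z"] by simp
qed

lemma bl_tensor_bounded:
  assumes "\<Phi> \<in> bl_tensor m"
  shows "\<exists>C. \<forall>x\<in>mspace m. \<forall>z\<in>mspace m. \<bar>\<Phi> x z\<bar> \<le> C"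
  using assms
proof (induction \<Phi>)
  case (product A B)
  obtain C where C: "0 < C" "\<And>x. x \<in> mspace m \<Longrightarrow> \<bar>A x\<bar> \<le> C"
    by (rule bl_functionsE[OF product(1)]) iprover
  obtain K where K: "0 < K" "\<And>x. x \<in> mspace m \<Longrightarrow> \<bar>B x\<bar> \<le> K"
    by (rule bl_functionsE[OF product(2)]) iprover
  show ?case
    unfolding abs_mult using C K by (intro exI[of _ "C * K"] ballI mult_mono) auto
next
  case (add \<Phi> \<Psi>)
  then obtain C K where "\<forall>x\<in>mspace m. \<forall>z\<in>mspace m. \<bar>\<Phi> x z\<bar> \<le> C"
    "\<forall>x\<in>mspace m. \<forall>z\<in>mspace m. \<bar>\<Psi> x z\<bar> \<le> K" by blast
  then have "\<forall>x\<in>mspace m. \<forall>z\<in>mspace m. \<bar>\<Phi> x z + \<Psi> x z\<bar> \<le> C + K"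
    using abs_triangle_ineq add_mono order_trans by meson
  then show ?case by blast
qed

lemma bl_tensor_measurable:
  assumes "\<Phi> \<in> bl_tensor m"
  shows "(\<lambda>p. \<Phi> (fst p) (snd p)) \<in> borel_measurable (ball_algebra m \<Otimes>\<^sub>M ball_algebra m)"
  using assms
proof (induction \<Phi>)
  case (product A B)
  note [measurable] = product[THEN bl_functions_measurable]
  show ?case by measurable
next
  case (add \<Phi> \<Psi>)
  note [measurable] = add.IH
  show ?case by measurable
qed

section \<open>Integrals of bounded functions\<close>

lemma (in prob_space) bounded_integrable:
  fixes f :: "'a \<Rightarrow> real"
  assumes "f \<in> borel_measurable M" "\<And>x. x \<in> space M \<Longrightarrow> \<bar>f x\<bar> \<le> C"
  shows "integrable M f"
  using assms by (intro integrable_const_bound[of _ C]) auto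

lemma (in prob_space) bounded_abs_integral_le:
  fixes f :: "'a \<Rightarrow> real"
  assumes "f \<in> borel_measurable M" "\<And>x. x \<in> space M \<Longrightarrow> \<bar>f x\<bar> \<le> C"
  shows "\<bar>\<integral>x. f x \<partial>M\<bar> \<le> C"
proof -
  note int = bounded_integrable[OF assms]
  have "\<bar>\<integral>x. f x \<partial>M\<bar> \<le> (\<integral>x. \<bar>f x\<bar> \<partial>M)"
    by (rule integral_abs_bound)
  also have "\<dots> \<le> C"
    using int assms(2) by (intro integral_le_const AE_I2) auto
  finally show ?thesis .
qed

section \<open>The bounded Lipschitz distance\<close>

lemma BL1_ball_zero: "(\<lambda>x. 0) \<in> BL1_ball m"
  by (simp add: BL1_ball_def mdist_nonneg)

lemma BL1_ballD:
  assumes "u \<in> BL1_ball m"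
  shows "u \<in> borel_measurable (ball_algebra m)"
    "\<And>x. x \<in> mspace m \<Longrightarrow> \<bar>u x\<bar> \<le> 1"
    "\<And>x y. x \<in> mspace m \<Longrightarrow> y \<in> mspace m \<Longrightarrow> \<bar>u x - u y\<bar> \<le> mdist m x y"
  using assms by (auto simp: BL1_ball_def)

lemma bounded_integral_diff_le:
  fixes g :: "'a \<Rightarrow> real"
  assumes "prob_space M" and X [measurable]: "X \<in> measurable M (ball_algebra m)"
    and "prob_space N" and Y [measurable]: "Y \<in> measurable N (ball_algebra m)"
    and g [measurable]: "g \<in> borel_measurable (ball_algebra m)"
    and bound: "\<And>x. x \<in> mspace m \<Longrightarrow> \<bar>g x\<bar> \<le> C"
  shows "\<bar>(\<integral>w. g (X w) \<partial>M) - (\<integral>w. g (Y w) \<partial>N)\<bar> \<le> 2 * C"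
proof -
  have "\<bar>\<integral>w. g (X w) \<partial>M\<bar> \<le> C"
    using measurable_space[OF X] bound
    by (intro prob_space.bounded_abs_integral_le[OF assms(1)]) (auto simp: space_ball_algebra)
  moreover have "\<bar>\<integral>w. g (Y w) \<partial>N\<bar> \<le> C"
    using measurable_space[OF Y] bound
    by (intro prob_space.bounded_abs_integral_le[OF assms(3)]) (auto simp: space_ball_algebra)
  ultimately show ?thesis by linarith
qed

lemma BL1_ball_integral_diff_le_dist_BL:
  assumes "prob_space M" "X \<in> measurable M (ball_algebra m)"
    and "prob_space N" "Y \<in> measurable N (ball_algebra m)"
    and u: "u \<in> BL1_ball m"
  shows "\<bar>(\<integral>w. u (X w) \<partial>M) - (\<integral>w. u (Y w) \<partial>N)\<bar>
    \<le> dist_BL_ball m (distr M (ball_algebra m) X) (distr N (ball_algebra m) Y)"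
proof -
  \<comment> \<open>A real supremum is an upper bound only if the set is bounded above; both means
    lie in [-1, 1], so 2 is such a bound.\<close>
  have "\<bar>(\<integral>x. v x \<partial>distr M (ball_algebra m) X) - (\<integral>x. v x \<partial>distr N (ball_algebra m) Y)\<bar> \<le> 2 * 1"
    if v: "v \<in> BL1_ball m" for v
    using bounded_integral_diff_le[OF assms(1-4) BL1_ballD(1,2)[OF v]]
    by (simp add: integral_distr assms(2,4) BL1_ballD(1)[OF v])
  then have "\<bar>(\<integral>x. u x \<partial>distr M (ball_algebra m) X) - (\<integral>x. u x \<partial>distr N (ball_algebra m) Y)\<bar>
      \<le> dist_BL_ball m (distr M (ball_algebra m) X) (distr N (ball_algebra m) Y)"
    unfolding dist_BL_ball_def by (intro cSUP_upper u bdd_aboveI2)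
  then show ?thesis
    using assms(2,4) BL1_ballD(1)[OF u] by (simp add: integral_distr)
qed

text \<open>Dividing by \<open>C\<close> moves \<open>g\<close> into the unit ball over which the
  distance is a supremum.\<close>

lemma bl_functions_diff_le_dist_BL:
  assumes "prob_space M" "X \<in> measurable M (ball_algebra m)"
    and "prob_space N" "Y \<in> measurable N (ball_algebra m)"
    and C: "0 < C" "\<And>x. x \<in> mspace m \<Longrightarrow> \<bar>g x\<bar> \<le> C"
    "\<And>x y. x \<in> mspace m \<Longrightarrow> y \<in> mspace m \<Longrightarrow> \<bar>g x - g y\<bar> \<le> C * mdist m x y"
    and g: "g \<in> borel_measurable (ball_algebra m)"
  shows "\<bar>(\<integral>w. g (X w) \<partial>M) - (\<integral>w. g (Y w) \<partial>N)\<bar>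
    \<le> C * dist_BL_ball m (distr M (ball_algebra m) X) (distr N (ball_algebra m) Y)"
proof -
  have "(\<lambda>x. g x / C) \<in> BL1_ball m"
    using g C by (auto simp: BL1_ball_def diff_divide_distrib[symmetric] divide_le_eq mult.commute)
  note * = BL1_ball_integral_diff_le_dist_BL[OF assms(1-4) this]
  have "\<bar>(\<integral>w. g (X w) / C \<partial>M) - (\<integral>w. g (Y w) / C \<partial>N)\<bar>
      = \<bar>(\<integral>w. g (X w) \<partial>M) - (\<integral>w. g (Y w) \<partial>N)\<bar> / C"
    using C(1) by (simp add: diff_divide_distrib[symmetric])
  then show ?thesis using * C(1) by (simp add: divide_le_eq mult.commute)
qed

section \<open>Measurability and separability\<close>

text \<open>Maxima of finitely many cones with rational heights and apices in a dense sequence form a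
  countable family that is pointwise sequentially dense in the test functions; this is what makes
  the supremum over all test functions measurable in a parameter.\<close>

fun cone_envelope :: "(nat \<Rightarrow> 'e::metric_space) \<Rightarrow> (nat \<times> rat) list \<Rightarrow> 'e \<Rightarrow> real" where
  "cone_envelope e [] x = -1"
| "cone_envelope e (p # l) x = max (of_rat (snd p) - dist x (e (fst p))) (cone_envelope e l x)"

lemma cone_envelope_ge_m1: "-1 \<le> cone_envelope e l x"
  by (induction l) auto

lemma cone_envelope_le:
  assumes "-1 \<le> c" "\<And>p. p \<in> set l \<Longrightarrow> of_rat (snd p) - dist x (e (fst p)) \<le> c"
  shows "cone_envelope e l x \<le> c"
  using assms by (induction l) auto

lemma cone_envelope_ge:
  assumes "p \<in> set l"
  shows "of_rat (snd p) - dist x (e (fst p)) \<le> cone_envelope e l x"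
  using assms by (induction l) auto

lemma cone_envelope_lipschitz: "\<bar>cone_envelope e l x - cone_envelope e l y\<bar> \<le> dist x y"
proof (induction l)
  case (Cons p l)
  have "\<bar>dist x (e (fst p)) - dist y (e (fst p))\<bar> \<le> dist x y"
    using dist_triangle[of x "e (fst p)" y] dist_triangle[of y "e (fst p)" x] dist_commute[of x y]
    by linarith
  with Cons show ?case by (auto simp: max_def)
qed simp

lemma cone_envelope_measurable [measurable]:
  "cone_envelope e l \<in> borel_measurable (borel :: 'e::{metric_space, second_countable_topology} measure)"
proof (induction l)
  case (Cons p l)
  note [measurable] = Cons
  show ?case by simp
qed simp

text \<open>Clipping from above suffices: the envelope starts from -1, the least value of a test
  function, at the empty list.\<close>

definition cone_test :: "(nat \<Rightarrow> 'e::metric_space) \<Rightarrow> (nat \<times> rat) list \<Rightarrow> 'e \<Rightarrow> real" where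
  "cone_test e l x = min 1 (cone_envelope e l x)"

lemma cone_test_BL1_ball:
  fixes e :: "nat \<Rightarrow> 'e::{metric_space, second_countable_topology}"
  shows "cone_test e l \<in> BL1_ball euclidean_metric"
proof -
  have "\<bar>cone_test e l x - cone_test e l y\<bar> \<le> dist x y" for x y
    using cone_envelope_lipschitz[of e l x y] unfolding cone_test_def by (auto simp: min_def)
  moreover have "\<bar>cone_test e l x\<bar> \<le> 1" for x
    using cone_envelope_ge_m1[of e l x] unfolding cone_test_def by (auto simp: min_def)
  moreover have "cone_test e l \<in> borel_measurable borel"
    unfolding cone_test_def[abs_def] by measurable
  ultimately show ?thesis by (simp add: BL1_ball_def ball_algebra_euclidean)
qed

text \<open>This is the McShane formula: a 1-Lipschitz \<open>g\<close> is the supremum of the cones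
  \<open>g (e i) - dist x (e i)\<close> over a dense sequence. The \<open>k\<close>-th list holds
  the cones at the first \<open>k\<close> points, with heights rounded to rationals within
  \<open>1 / Suc k\<close>. Cones stay below \<open>g\<close> up to the rounding error, and a cone
  at a point near \<open>x\<close> almost reaches \<open>g x\<close>.\<close>

lemma cone_test_approximates:
  fixes e :: "nat \<Rightarrow> 'e::{metric_space, second_countable_topology}"
  assumes dense: "\<And>x r. 0 < r \<Longrightarrow> \<exists>i. dist x (e i) < r"
    and g: "g \<in> BL1_ball euclidean_metric"
  obtains l where "\<And>x. (\<lambda>k. cone_test e (l k) x) \<longlonglongrightarrow> g x"
proof -
  have g_le: "\<bar>g x\<bar> \<le> 1" and g_lip: "\<bar>g x - g y\<bar> \<le> dist x y" for x y
    using BL1_ballD(2,3)[OF g] by auto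
  have "\<exists>q. \<bar>of_rat q - g (e i)\<bar> < 1 / real (Suc k)" for i k
  proof -
    have "g (e i) - 1 / real (Suc k) < g (e i) + 1 / real (Suc k)" by simp
    then obtain q where "g (e i) - 1 / real (Suc k) < of_rat q" "of_rat q < g (e i) + 1 / real (Suc k)"
      using of_rat_dense by blast
    then show ?thesis by (intro exI[of _ q]) linarith
  qed
  then obtain q where q: "\<And>i k. \<bar>of_rat (q i k) - g (e i)\<bar> < 1 / real (Suc k)" by metis
  define l where "l k = map (\<lambda>i. (i, q i k)) [0..<k]" for k
  have upper: "cone_test e (l k) x \<le> g x + 1 / real (Suc k)" for k x
  proof -
    have "cone_envelope e (l k) x \<le> g x + 1 / real (Suc k)"
    proof (rule cone_envelope_le)
      have "0 \<le> 1 / real (Suc k)" by simp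
      then show "-1 \<le> g x + 1 / real (Suc k)" using g_le[of x] by linarith
    next
      fix p assume "p \<in> set (l k)"
      then obtain i where "p = (i, q i k)" unfolding l_def by auto
      then show "of_rat (snd p) - dist x (e (fst p)) \<le> g x + 1 / real (Suc k)"
        using q[of i k] g_lip[of x "e i"] by simp
    qed
    then show ?thesis unfolding cone_test_def by linarith
  qed
  have lim: "(\<lambda>k. cone_test e (l k) x) \<longlonglongrightarrow> g x" for x
  proof (rule LIMSEQ_I)
    fix r :: real assume "0 < r"
    \<comment> \<open>The distance to \<open>e i\<close> is paid twice, once for the slope of the
      cone and once for the variation of \<open>g\<close>; the rounding error takes the remaining
      \<open>r/2\<close>.\<close>
    then obtain i where i: "dist x (e i) < r/4" using dense[of "r/4" x] by auto
    obtain N where N: "1 / real (Suc N) < r/2" using \<open>0 < r\<close> nat_approx_posE[of "r/2"] by auto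
    have "norm (cone_test e (l k) x - g x) < r" if k: "max (Suc i) N \<le> k" for k
    proof -
      have "1 / real (Suc k) \<le> 1 / real (Suc N)"
        using k by (intro divide_left_mono) auto
      then have small: "1 / real (Suc k) < r/2" using N by linarith
      have "(i, q i k) \<in> set (l k)" using k unfolding l_def by auto
      from cone_envelope_ge[OF this, of x e]
      have "of_rat (q i k) - dist x (e i) \<le> cone_envelope e (l k) x" by simp
      then have "g x - r < cone_envelope e (l k) x"
        using q[of i k] g_lip[of x "e i"] i small by linarith
      \<comment> \<open>Clipping at 1 does no harm because \<open>g x \<le> 1\<close> and
        \<open>0 < r\<close>.\<close>
      then have "g x - r < cone_test e (l k) x"
        unfolding cone_test_def using g_le[of x] \<open>0 < r\<close> by (auto simp: min_def)
      then show ?thesis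
        using upper[of k x] small unfolding real_norm_def by linarith
    qed
    then show "\<exists>no. \<forall>k\<ge>no. norm (cone_test e (l k) x - g x) < r" by blast
  qed
  show thesis by (rule that[OF lim])
qed

lemma dense_sequence_exists:
  "\<exists>e :: nat \<Rightarrow> 'e::{metric_space, second_countable_topology}. \<forall>x. \<forall>r>0. \<exists>i. dist x (e i) < r"
proof -
  obtain S :: "'e set" where S: "countable S" "\<And>U. open U \<Longrightarrow> U \<noteq> {} \<Longrightarrow> \<exists>d\<in>S. d \<in> U"
    using countable_dense_exists by metis
  have "S \<noteq> {}" using S(2)[of UNIV] by auto
  have "\<exists>i. dist x (from_nat_into S i) < r" if "0 < r" for x r
  proof -
    obtain d where d: "d \<in> S" "d \<in> ball x r" using S(2)[of "ball x r"] \<open>0 < r\<close> by auto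
    then obtain i where "from_nat_into S i = d" using from_nat_into_surj[OF S(1)] by blast
    then show ?thesis using d by (intro exI[of _ i]) simp
  qed
  then show ?thesis by blast
qed

text \<open>The cone tests are bounded by 1 and approximate any test function pointwise, so
  dominated convergence carries the approximation to both integrals at once. The index set of lists
  over \<open>nat \<times> rat\<close> is countable.\<close>

lemma dist_BL_eq_countable_SUP:
  fixes M N :: "'e::{metric_space, second_countable_topology} measure"
  assumes dense: "\<And>x r. 0 < r \<Longrightarrow> \<exists>i. dist x (e i) < r"
    and M: "prob_space M" "sets M = sets borel" and N: "prob_space N" "sets N = sets borel"
  shows "dist_BL_ball euclidean_metric M N
    = (SUP l. \<bar>(\<integral>x. cone_test e l x \<partial>M) - (\<integral>x. cone_test e l x \<partial>N)\<bar>)"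
proof -
  interpret M: prob_space M by (rule M)
  interpret N: prob_space N by (rule N)
  have [measurable_cong]: "sets M = sets borel" "sets N = sets borel" by fact+
  define d where "d u = \<bar>(\<integral>x. u x \<partial>M) - (\<integral>x. u x \<partial>N)\<bar>" for u :: "'e \<Rightarrow> real"
  have meas [measurable]: "u \<in> borel_measurable borel" if "u \<in> BL1_ball euclidean_metric"
    for u :: "'e \<Rightarrow> real"
    using BL1_ballD(1)[OF that] by (simp add: ball_algebra_euclidean)
  have d_le: "d u \<le> 2" if u: "u \<in> BL1_ball euclidean_metric" for u
  proof -
    have [measurable]: "u \<in> borel_measurable borel" by (rule meas[OF u])
    have "\<bar>\<integral>x. u x \<partial>M\<bar> \<le> 1" "\<bar>\<integral>x. u x \<partial>N\<bar> \<le> 1"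
      using BL1_ballD(2)[OF u]
      by (auto intro!: M.bounded_abs_integral_le N.bounded_abs_integral_le)
    then show ?thesis unfolding d_def by linarith
  qed
  have bdd: "bdd_above (range (\<lambda>l. d (cone_test e l)))"
    using d_le[OF cone_test_BL1_ball] by (intro bdd_aboveI2)
  have "dist_BL_ball euclidean_metric M N = (SUP u\<in>BL1_ball euclidean_metric. d u)"
    by (simp add: dist_BL_ball_def d_def)
  also have "\<dots> = (SUP l. d (cone_test e l))"
  proof (rule antisym)
    show "(SUP u\<in>BL1_ball euclidean_metric. d u) \<le> (SUP l. d (cone_test e l))"
    proof (rule cSUP_least)
      show "BL1_ball euclidean_metric \<noteq> ({} :: ('e \<Rightarrow> real) set)" using BL1_ball_zero by blast
      fix u :: "'e \<Rightarrow> real" assume u: "u \<in> BL1_ball euclidean_metric"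
      have [measurable]: "u \<in> borel_measurable borel" by (rule meas[OF u])
      have [measurable]: "cone_test e l \<in> borel_measurable borel" for l
        by (rule meas[OF cone_test_BL1_ball])
      have le1: "\<bar>cone_test e l x\<bar> \<le> 1" for l x
        using BL1_ballD(2)[OF cone_test_BL1_ball, of x e l] by simp
      obtain l where l: "\<And>x. (\<lambda>k. cone_test e (l k) x) \<longlonglongrightarrow> u x"
        using cone_test_approximates[OF dense u] by metis
      have "(\<lambda>k. \<integral>x. cone_test e (l k) x \<partial>M) \<longlonglongrightarrow> (\<integral>x. u x \<partial>M)"
        by (rule integral_dominated_convergence[where w="\<lambda>_. 1"]) (auto simp: l le1)
      moreover have "(\<lambda>k. \<integral>x. cone_test e (l k) x \<partial>N) \<longlonglongrightarrow> (\<integral>x. u x \<partial>N)"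
        by (rule integral_dominated_convergence[where w="\<lambda>_. 1"]) (auto simp: l le1)
      ultimately have "(\<lambda>k. d (cone_test e (l k))) \<longlonglongrightarrow> d u"
        unfolding d_def by (intro tendsto_intros)
      then show "d u \<le> (SUP l. d (cone_test e l))"
        by (rule LIMSEQ_le_const2) (auto intro!: cSUP_upper bdd)
    qed
    show "(SUP l. d (cone_test e l)) \<le> (SUP u\<in>BL1_ball euclidean_metric. d u)"
      using d_le by (intro cSUP_mono bdd_aboveI2) (auto intro: cone_test_BL1_ball)
  qed
  finally show ?thesis by (simp add: d_def)
qed

text \<open>For one cone test the mean of \<open>Y\<close> given \<open>\<omega>\<close> is
  measurable by Fubini, and the supremum over countably many of them stays measurable. This makes
  the bad sets events, so that no outer probability occurs in the conclusion.\<close>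

lemma dist_BL_kernel_measurable:
  fixes Y :: "'w \<times> 'v \<Rightarrow> 'e::{metric_space, second_countable_topology}"
  assumes "prob_space P'" and Y [measurable]: "Y \<in> borel_measurable (P \<Otimes>\<^sub>M P')"
    and "prob_space N" and W [measurable]: "W \<in> borel_measurable N"
  shows "(\<lambda>\<omega>. dist_BL_ball euclidean_metric (distr P' borel (\<lambda>\<omega>'. Y (\<omega>, \<omega>'))) (distr N borel W))
    \<in> borel_measurable P"
proof -
  interpret P': prob_space P' by fact
  interpret N: prob_space N by fact
  obtain e :: "nat \<Rightarrow> 'e" where e: "\<And>x r. 0 < r \<Longrightarrow> \<exists>i. dist x (e i) < r"
    using dense_sequence_exists by metis
  have [measurable]: "cone_test e l \<in> borel_measurable borel" for l
    using BL1_ballD(1)[OF cone_test_BL1_ball] by (metis ball_algebra_euclidean)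
  define d where "d l \<omega> = \<bar>(\<integral>\<omega>'. cone_test e l (Y (\<omega>, \<omega>')) \<partial>P') - (\<integral>t. cone_test e l (W t) \<partial>N)\<bar>"
    for l \<omega>
  have sect: "(\<lambda>\<omega>'. Y (\<omega>, \<omega>')) \<in> borel_measurable P'" if "\<omega> \<in> space P" for \<omega>
    using that by measurable
  have eq: "dist_BL_ball euclidean_metric (distr P' borel (\<lambda>\<omega>'. Y (\<omega>, \<omega>'))) (distr N borel W)
      = (SUP l. d l \<omega>)" if w: "\<omega> \<in> space P" for \<omega>
  proof -
    have [measurable]: "(\<lambda>\<omega>'. Y (\<omega>, \<omega>')) \<in> borel_measurable P'" by (rule sect[OF w])
    show ?thesis
      by (subst dist_BL_eq_countable_SUP[OF e])
        (auto simp: d_def integral_distr intro!: P'.prob_space_distr N.prob_space_distr)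
  qed
  have bdd: "bdd_above (range (\<lambda>l. d l \<omega>))" if w: "\<omega> \<in> space P" for \<omega>
  proof (rule bdd_aboveI2)
    fix l
    have [measurable]: "(\<lambda>\<omega>'. Y (\<omega>, \<omega>')) \<in> borel_measurable P'" by (rule sect[OF w])
    have "\<bar>cone_test e l x\<bar> \<le> 1" for x
      using BL1_ballD(2)[OF cone_test_BL1_ball, of x e l] by simp
    then have "\<bar>\<integral>\<omega>'. cone_test e l (Y (\<omega>, \<omega>')) \<partial>P'\<bar> \<le> 1" "\<bar>\<integral>t. cone_test e l (W t) \<partial>N\<bar> \<le> 1"
      by (auto intro!: P'.bounded_abs_integral_le N.bounded_abs_integral_le)
    then show "d l \<omega> \<le> 2" unfolding d_def by linarith
  qed
  have "d l \<in> borel_measurable P" for l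
    unfolding d_def[abs_def] by measurable
  then have "(\<lambda>\<omega>. SUP l. d l \<omega>) \<in> borel_measurable P"
    using bdd by (intro borel_measurable_cSUP) auto
  then show ?thesis by (simp add: eq cong: measurable_cong)
qed

section \<open>Countable covers and measurability on a separable subset\<close>

lemma separable_subset_dense:
  assumes "separable_space (subtopology (mtopology_of m) E0)" "E0 \<subseteq> mspace m"
  obtains Q where "countable Q" "Q \<subseteq> E0" "\<And>u r. u \<in> E0 \<Longrightarrow> 0 < r \<Longrightarrow> \<exists>q\<in>Q. mdist m u q < r"
proof -
  have top: "topspace (subtopology (mtopology_of m) E0) = E0"
    using assms(2) by auto
  then obtain Q where Q: "countable Q" "Q \<subseteq> E0" "subtopology (mtopology_of m) E0 closure_of Q = E0"
    using assms(1) unfolding separable_space_def top by metis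
  have "\<exists>q\<in>Q. mdist m u q < r" if u: "u \<in> E0" and r: "0 < r" for u r
  proof -
    have "E0 \<inter> (mtopology_of m closure_of Q) = E0"
      using Q(2,3) by (simp add: closure_of_subtopology Int_absorb1)
    then have "u \<in> mtopology_of m closure_of Q" using u by blast
    then have "\<exists>q\<in>Q. q \<in> Metric_space.mball (mspace m) (mdist m) u r"
      unfolding mtopology_of_def Metric_space.metric_closure_of[OF Metric_space_mspace_mdist]
      using r by blast
    then show ?thesis by (auto simp: Metric_space.in_mball[OF Metric_space_mspace_mdist])
  qed
  then show thesis using that Q(1,2) by blast
qed

text \<open>A Lindelof argument for radii that depend on the centre without a positive lower bound,
  so that dense points cannot serve as centres themselves. Each triple of two dense points and a
  scale \<open>k\<close> selects one pair close to the dense points whose own radius is large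
  compared with \<open>1 / Suc k\<close>.\<close>

lemma separable_pair_cover:
  fixes \<rho> :: "'a \<times> 'a \<Rightarrow> real"
  assumes sep: "separable_space (subtopology (mtopology_of m) E0)" and sub: "E0 \<subseteq> mspace m"
    and ne: "E0 \<noteq> {}" and pos: "\<And>p. p \<in> E0 \<times> E0 \<Longrightarrow> 0 < \<rho> p"
  obtains c :: "nat \<Rightarrow> 'a \<times> 'a" where "\<And>i. c i \<in> E0 \<times> E0"
    "\<And>u v. u \<in> E0 \<Longrightarrow> v \<in> E0 \<Longrightarrow>
      \<exists>i. mdist m (fst (c i)) u < \<rho> (c i) \<and> mdist m (snd (c i)) v < \<rho> (c i)"
proof -
  obtain Q where Q: "countable Q" "Q \<subseteq> E0" "\<And>u r. u \<in> E0 \<Longrightarrow> 0 < r \<Longrightarrow> \<exists>q\<in>Q. mdist m u q < r"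
    using separable_subset_dense[OF sep sub] by metis
  \<comment> \<open>The factor 2 pays for the triangle inequality: centre to dense point and dense
    point to target each cost less than \<open>1 / Suc k\<close>.\<close>
  define near where "near t p \<longleftrightarrow> p \<in> E0 \<times> E0 \<and> mdist m (fst p) (fst t) < 1 / real (Suc (snd (snd t)))
      \<and> mdist m (snd p) (fst (snd t)) < 1 / real (Suc (snd (snd t)))
      \<and> 2 * (1 / real (Suc (snd (snd t)))) \<le> \<rho> p" for t :: "'a \<times> 'a \<times> nat" and p
  define C where "C = (\<lambda>t. SOME p. near t p) ` {t \<in> Q \<times> Q \<times> UNIV. \<exists>p. near t p}"
  have "countable (Q \<times> Q \<times> (UNIV :: nat set))" using Q(1) by auto
  then have "countable C" unfolding C_def
    by (intro countable_image) (rule countable_subset, auto)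
  have C_sub: "C \<subseteq> E0 \<times> E0"
  proof
    fix p assume "p \<in> C"
    then obtain t where "p = (SOME p. near t p)" "\<exists>p. near t p" unfolding C_def by blast
    then have "near t p" by (metis someI_ex)
    then show "p \<in> E0 \<times> E0" by (simp add: near_def)
  qed
  have cover: "\<exists>p\<in>C. mdist m (fst p) u < \<rho> p \<and> mdist m (snd p) v < \<rho> p"
    if u: "u \<in> E0" and v: "v \<in> E0" for u v
  proof -
    have "0 < \<rho> (u, v) / 2" using pos u v by simp
    then obtain k where k: "1 / real (Suc k) < \<rho> (u, v) / 2" using nat_approx_posE by blast
    obtain q where q: "q \<in> Q" "mdist m u q < 1 / real (Suc k)" using Q(3)[OF u, of "1 / real (Suc k)"] by auto
    obtain q' where q': "q' \<in> Q" "mdist m v q' < 1 / real (Suc k)" using Q(3)[OF v, of "1 / real (Suc k)"] by auto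
    \<comment> \<open>The target pair itself shows that its triple has a candidate; the pair
      actually selected for the triple may be a different one.\<close>
    have ex: "near (q, q', k) (u, v)" unfolding near_def using u v q q' k by auto
    define p where "p = (SOME p. near (q, q', k) p)"
    have p: "near (q, q', k) p" unfolding p_def by (rule someI[of _ "(u, v)"]) (rule ex)
    have "p \<in> C" unfolding C_def p_def using q(1) q'(1) ex by (intro imageI) auto
    moreover have "mdist m (fst p) u < \<rho> p"
      using mdist_triangle[of "fst p" m q u] p q Q(2) u sub mdist_commute[of m u q]
      unfolding near_def by (auto simp: subset_iff)
    moreover have "mdist m (snd p) v < \<rho> p"
      using mdist_triangle[of "snd p" m q' v] p q' Q(2) v sub mdist_commute[of m v q']
      unfolding near_def by (auto simp: subset_iff)
    ultimately show ?thesis by blast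
  qed
  have "C \<noteq> {}" using ne cover by blast
  show thesis
  proof (rule that[of "from_nat_into C"])
    show "from_nat_into C i \<in> E0 \<times> E0" for i
      using from_nat_into[OF \<open>C \<noteq> {}\<close>] C_sub by blast
    show "\<exists>i. mdist m (fst (from_nat_into C i)) u < \<rho> (from_nat_into C i)
        \<and> mdist m (snd (from_nat_into C i)) v < \<rho> (from_nat_into C i)"
      if "u \<in> E0" "v \<in> E0" for u v
      using cover[OF that] from_nat_into_surj[OF \<open>countable C\<close>] by metis
  qed
qed

text \<open>The open-ball algebra may miss open sets, so continuity alone does not give
  measurability. Since \<open>\<xi>\<close> stays in \<open>E0\<close>, the preimage of
  \<open>U\<close> is a countable union of preimages of balls: those with dense centre and radius
  \<open>1 / Suc k\<close> whose trace on \<open>E0\<close> is mapped into \<open>U\<close>.\<close>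

lemma continuous_on_separable_measurable:
  fixes K :: "'a \<Rightarrow> 'e::metric_space"
  assumes sep: "separable_space (subtopology (mtopology_of m) E0)" and sub: "E0 \<subseteq> mspace m"
    and \<xi> [measurable]: "\<xi> \<in> measurable N (ball_algebra m)" and \<xi>E0: "\<And>t. t \<in> space N \<Longrightarrow> \<xi> t \<in> E0"
    and K: "\<And>z e. z \<in> E0 \<Longrightarrow> 0 < e \<Longrightarrow> \<exists>r>0. \<forall>v\<in>E0. mdist m z v < r \<longrightarrow> dist (K v) (K z) < e"
  shows "(\<lambda>t. K (\<xi> t)) \<in> borel_measurable N"
proof (rule borel_measurableI)
  fix U :: "'e set" assume U: "open U"
  obtain Q where Q: "countable Q" "Q \<subseteq> E0" "\<And>u r. u \<in> E0 \<Longrightarrow> 0 < r \<Longrightarrow> \<exists>q\<in>Q. mdist m u q < r"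
    using separable_subset_dense[OF sep sub] by metis
  define J where "J = {p \<in> Q \<times> (UNIV :: nat set).
    \<forall>v\<in>E0. mdist m (fst p) v < 1 / real (Suc (snd p)) \<longrightarrow> K v \<in> U}"
  have "countable J" unfolding J_def
    by (rule countable_subset[of _ "Q \<times> UNIV"]) (use Q(1) in auto)
  have "(\<lambda>t. K (\<xi> t)) -` U \<inter> space N
      = (\<Union>p\<in>J. \<xi> -` mball_of m (fst p) (1 / real (Suc (snd p))) \<inter> space N)" (is "?L = ?R")
  proof
    show "?R \<subseteq> ?L" unfolding J_def using \<xi>E0 by auto
    show "?L \<subseteq> ?R"
    proof
      fix t assume t: "t \<in> ?L"
      then have "\<xi> t \<in> E0" "K (\<xi> t) \<in> U" using \<xi>E0 by auto
      obtain e where e: "0 < e" "\<And>y. dist y (K (\<xi> t)) < e \<Longrightarrow> y \<in> U"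
        using U \<open>K (\<xi> t) \<in> U\<close> by (meson open_dist)
      obtain r where r: "0 < r" "\<And>v. v \<in> E0 \<Longrightarrow> mdist m (\<xi> t) v < r \<Longrightarrow> dist (K v) (K (\<xi> t)) < e"
        using K[OF \<open>\<xi> t \<in> E0\<close> e(1)] by blast
      \<comment> \<open>Half the radius leaves room for the ball around the dense point
        \<open>q\<close> to lie within distance \<open>r\<close> of \<open>\<xi> t\<close>.\<close>
      obtain k where k: "1 / real (Suc k) < r / 2" using r(1) nat_approx_posE[of "r / 2"] by auto
      obtain q where q: "q \<in> Q" "mdist m (\<xi> t) q < 1 / real (Suc k)"
        using Q(3)[OF \<open>\<xi> t \<in> E0\<close>, of "1 / real (Suc k)"] by auto
      have mem: "\<xi> t \<in> mspace m" "q \<in> mspace m" using \<open>\<xi> t \<in> E0\<close> q(1) Q(2) sub by auto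
      have "K v \<in> U" if v: "v \<in> E0" "mdist m q v < 1 / real (Suc k)" for v
      proof -
        have "mdist m (\<xi> t) v \<le> mdist m (\<xi> t) q + mdist m q v"
          using mem v(1) sub by (intro mdist_triangle) auto
        then have "mdist m (\<xi> t) v < r" using q(2) v(2) k by linarith
        then show ?thesis using e(2) r(2) v(1) by blast
      qed
      then have "(q, k) \<in> J" unfolding J_def using q(1) by auto
      moreover have "\<xi> t \<in> mball_of m q (1 / real (Suc k))"
        using mem q(2) by (simp add: mdist_commute)
      ultimately show "t \<in> ?R" using t by (intro UN_I[of "(q, k)"]) auto
    qed
  qed
  moreover have "\<dots> \<in> sets N"
  proof (rule sets.countable_UN''[OF \<open>countable J\<close>])
    fix p assume "p \<in> J"
    then have "fst p \<in> mspace m" unfolding J_def using Q(2) sub by auto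
    then show "\<xi> -` mball_of m (fst p) (1 / real (Suc (snd p))) \<inter> space N \<in> sets N"
      by (intro measurable_sets[OF \<xi>] mball_in_ball_algebra)
  qed
  ultimately show "(\<lambda>t. K (\<xi> t)) -` U \<inter> space N \<in> sets N" by simp
qed

text \<open>With leftover \<open>p = 1 - (\<Sum>j<k. \<psi> j)\<close> the error equals
  \<open>p * v + (\<Sum>j<k. (v - c j) * \<psi> j)\<close>. The first term is at most
  \<open>p\<close>; the second is an average of deviations that matter only where
  \<open>\<psi> j\<close> is positive.\<close>

lemma partition_of_unity_estimate:
  fixes \<psi> c :: "nat \<Rightarrow> real"
  assumes nonneg: "\<And>j. j < k \<Longrightarrow> 0 \<le> \<psi> j" and sum: "(\<Sum>j<k. \<psi> j) = 1 - p" and p: "0 \<le> p"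
    and v: "\<bar>v\<bar> \<le> 1" and close: "\<And>j. j < k \<Longrightarrow> 0 < \<psi> j \<Longrightarrow> \<bar>v - c j\<bar> \<le> \<epsilon>" and "0 \<le> \<epsilon>"
  shows "\<bar>v - (\<Sum>j<k. c j * \<psi> j)\<bar> \<le> p + \<epsilon>"
proof -
  have "(\<Sum>j<k. (v - c j) * \<psi> j) = v * (\<Sum>j<k. \<psi> j) - (\<Sum>j<k. c j * \<psi> j)"
    by (simp add: left_diff_distrib sum_subtractf sum_distrib_left)
  then have "v - (\<Sum>j<k. c j * \<psi> j) = p * v + (\<Sum>j<k. (v - c j) * \<psi> j)"
    unfolding sum by (simp add: algebra_simps)
  then have "\<bar>v - (\<Sum>j<k. c j * \<psi> j)\<bar> \<le> \<bar>p * v\<bar> + \<bar>\<Sum>j<k. (v - c j) * \<psi> j\<bar>"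
    by (metis abs_triangle_ineq)
  also have "\<bar>\<Sum>j<k. (v - c j) * \<psi> j\<bar> \<le> (\<Sum>j<k. \<epsilon> * \<psi> j)"
  proof (rule order_trans[OF sum_abs sum_mono])
    fix j assume "j \<in> {..<k}"
    then have j: "j < k" by simp
    show "\<bar>(v - c j) * \<psi> j\<bar> \<le> \<epsilon> * \<psi> j"
      using nonneg[OF j] close[OF j] by (cases "\<psi> j = 0") (auto simp: abs_mult intro!: mult_right_mono)
  qed
  also have "(\<Sum>j<k. \<epsilon> * \<psi> j) = \<epsilon> * (1 - p)" by (simp add: sum sum_distrib_left[symmetric])
  also have "\<dots> \<le> \<epsilon>" using p \<open>0 \<le> \<epsilon>\<close> by (simp add: mult_left_le)
  also have "\<bar>p * v\<bar> \<le> p" using p v by (simp add: abs_mult mult_left_le)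
  finally show ?thesis by simp
qed

lemma (in prob_space) partition_of_unity_integral_estimate:
  fixes \<psi> :: "nat \<Rightarrow> 'a \<Rightarrow> real"
  assumes int: "\<And>j. integrable M (\<psi> j)" "integrable M p" "integrable M v"
    and pw: "\<And>x. x \<in> space M \<Longrightarrow> \<bar>v x - (\<Sum>j<k. c j * \<psi> j x)\<bar> \<le> p x + \<epsilon>"
  shows "\<bar>(\<integral>x. v x \<partial>M) - (\<Sum>j<k. c j * (\<integral>x. \<psi> j x \<partial>M))\<bar> \<le> (\<integral>x. p x \<partial>M) + \<epsilon>"
proof -
  have "(\<integral>x. v x \<partial>M) - (\<Sum>j<k. c j * (\<integral>x. \<psi> j x \<partial>M)) = (\<integral>x. v x - (\<Sum>j<k. c j * \<psi> j x) \<partial>M)"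
    using int by simp
  also have "\<bar>\<dots>\<bar> \<le> (\<integral>x. \<bar>v x - (\<Sum>j<k. c j * \<psi> j x)\<bar> \<partial>M)"
    by (rule integral_abs_bound)
  also have "\<dots> \<le> (\<integral>x. p x + \<epsilon> \<partial>M)"
    using int pw by (intro integral_mono) auto
  also have "\<dots> = (\<integral>x. p x \<partial>M) + \<epsilon>"
    using int by (simp add: prob_space)
  finally show ?thesis .
qed

section \<open>Joint convergence of a variable and a conditionally convergent one\<close>

text \<open>\<open>Z_lim\<close> is the mean convergence that both bootstrap modes imply. The two
  limits live on separate spaces and appear jointly only through iterated integrals, that is, as
  independent variables; separate spaces also allow a degenerate first component.\<close>

locale conditional_bl_convergence =
  P: prob_space P + P': prob_space P' + Q1: prob_space Q1 + Q2: prob_space Q2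
  for P :: "'w measure" and P' :: "'v measure" and Q1 :: "'s measure" and Q2 :: "'t measure" +
  fixes m :: "'a metric" and X :: "nat \<Rightarrow> 'w \<Rightarrow> 'a" and Z :: "nat \<Rightarrow> 'w \<times> 'v \<Rightarrow> 'a"
    and \<xi>1 :: "'s \<Rightarrow> 'a" and \<xi>2 :: "'t \<Rightarrow> 'a"
  assumes X_meas [measurable]: "\<And>n. X n \<in> measurable P (ball_algebra m)"
    and Z_meas [measurable]: "\<And>n. Z n \<in> measurable (P \<Otimes>\<^sub>M P') (ball_algebra m)"
    and \<xi>1_meas [measurable]: "\<xi>1 \<in> measurable Q1 (ball_algebra m)"
    and \<xi>2_meas [measurable]: "\<xi>2 \<in> measurable Q2 (ball_algebra m)"
    and X_lim: "\<And>A. A \<in> bl_functions m \<Longrightarrow>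
      (\<lambda>n. \<integral>\<omega>. A (X n \<omega>) \<partial>P) \<longlonglongrightarrow> (\<integral>s. A (\<xi>1 s) \<partial>Q1)"
    and Z_lim: "\<And>B. B \<in> bl_functions m \<Longrightarrow>
      (\<lambda>n. \<integral>\<omega>. \<bar>(\<integral>\<omega>'. B (Z n (\<omega>, \<omega>')) \<partial>P') - (\<integral>t. B (\<xi>2 t) \<partial>Q2)\<bar> \<partial>P) \<longlonglongrightarrow> 0"
begin

section \<open>Measurability and integrability of tensors along the sequences and at the
  limit\<close>

lemma X_space: "\<omega> \<in> space P \<Longrightarrow> X n \<omega> \<in> mspace m"
  using measurable_space[OF X_meas] by (simp add: space_ball_algebra)

lemma Z_space: "\<omega> \<in> space P \<Longrightarrow> \<omega>' \<in> space P' \<Longrightarrow> Z n (\<omega>, \<omega>') \<in> mspace m"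
  using measurable_space[OF Z_meas, of "(\<omega>, \<omega>')" n] by (simp add: space_ball_algebra space_pair_measure)

lemma \<xi>1_space: "s \<in> space Q1 \<Longrightarrow> \<xi>1 s \<in> mspace m"
  using measurable_space[OF \<xi>1_meas] by (simp add: space_ball_algebra)

lemma \<xi>2_space: "t \<in> space Q2 \<Longrightarrow> \<xi>2 t \<in> mspace m"
  using measurable_space[OF \<xi>2_meas] by (simp add: space_ball_algebra)

lemma tensor_compose_measurable:
  assumes \<Phi>: "\<Phi> \<in> bl_tensor m"
    and "f \<in> measurable M (ball_algebra m)" "g \<in> measurable M (ball_algebra m)"
  shows "(\<lambda>x. \<Phi> (f x) (g x)) \<in> borel_measurable M"
  using measurable_compose[OF measurable_Pair[OF assms(2,3)] bl_tensor_measurable[OF \<Phi>]] by simp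

lemma tensor_XZ_measurable:
  assumes "\<Phi> \<in> bl_tensor m"
  shows "(\<lambda>(\<omega>, \<omega>'). \<Phi> (X n \<omega>) (Z n (\<omega>, \<omega>'))) \<in> borel_measurable (P \<Otimes>\<^sub>M P')"
  using tensor_compose_measurable[OF assms, of "\<lambda>p. X n (fst p)" "P \<Otimes>\<^sub>M P'" "Z n"]
  by (simp add: case_prod_beta')

lemma tensor_XZ_section_measurable:
  assumes "\<Phi> \<in> bl_tensor m" "\<omega> \<in> space P"
  shows "(\<lambda>\<omega>'. \<Phi> (X n \<omega>) (Z n (\<omega>, \<omega>'))) \<in> borel_measurable P'"
  using measurable_compose[OF measurable_Pair1'[OF assms(2)] tensor_XZ_measurable[OF assms(1)]] by simp

lemma tensor_X\<xi>_measurable: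
  assumes "\<Phi> \<in> bl_tensor m"
  shows "(\<lambda>(\<omega>, t). \<Phi> (X n \<omega>) (\<xi>2 t)) \<in> borel_measurable (P \<Otimes>\<^sub>M Q2)"
  using tensor_compose_measurable[OF assms, of "\<lambda>p. X n (fst p)" "P \<Otimes>\<^sub>M Q2" "\<lambda>p. \<xi>2 (snd p)"]
  by (simp add: case_prod_beta')

lemma tensor_\<xi>\<xi>_measurable:
  assumes "\<Phi> \<in> bl_tensor m"
  shows "(\<lambda>(s, t). \<Phi> (\<xi>1 s) (\<xi>2 t)) \<in> borel_measurable (Q1 \<Otimes>\<^sub>M Q2)"
  using tensor_compose_measurable[OF assms, of "\<lambda>p. \<xi>1 (fst p)" "Q1 \<Otimes>\<^sub>M Q2" "\<lambda>p. \<xi>2 (snd p)"]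
  by (simp add: case_prod_beta')

lemma tensor_\<xi>2_measurable:
  assumes "\<Phi> \<in> bl_tensor m" "x \<in> mspace m"
  shows "(\<lambda>t. \<Phi> x (\<xi>2 t)) \<in> borel_measurable Q2"
  using assms(2) by (intro tensor_compose_measurable[OF assms(1)]) (auto simp: space_ball_algebra)

definition cond_mean :: "('a \<Rightarrow> 'a \<Rightarrow> real) \<Rightarrow> nat \<Rightarrow> 'w \<Rightarrow> real" where
  "cond_mean \<Phi> n \<omega> = (\<integral>\<omega>'. \<Phi> (X n \<omega>) (Z n (\<omega>, \<omega>')) \<partial>P')"

text \<open>The intermediate object between the conditional mean and the limit: the second argument
  is already replaced by its limit, while the first is kept at a given value. Evaluated at
  \<open>X n\<close>, it remains random.\<close>

definition limit_mean :: "('a \<Rightarrow> 'a \<Rightarrow> real) \<Rightarrow> 'a \<Rightarrow> real" where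
  "limit_mean \<Phi> x = (\<integral>t. \<Phi> x (\<xi>2 t) \<partial>Q2)"

lemma cond_mean_measurable: "\<Phi> \<in> bl_tensor m \<Longrightarrow> cond_mean \<Phi> n \<in> borel_measurable P"
  unfolding cond_mean_def[abs_def]
  by (intro P'.borel_measurable_lebesgue_integral tensor_XZ_measurable)

lemma limit_mean_X_measurable: "\<Phi> \<in> bl_tensor m \<Longrightarrow> (\<lambda>\<omega>. limit_mean \<Phi> (X n \<omega>)) \<in> borel_measurable P"
  unfolding limit_mean_def by (intro Q2.borel_measurable_lebesgue_integral tensor_X\<xi>_measurable)

lemma limit_mean_\<xi>1_measurable: "\<Phi> \<in> bl_tensor m \<Longrightarrow> (\<lambda>s. limit_mean \<Phi> (\<xi>1 s)) \<in> borel_measurable Q1"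
  unfolding limit_mean_def by (intro Q2.borel_measurable_lebesgue_integral tensor_\<xi>\<xi>_measurable)

lemma tensor_integrable:
  assumes \<Phi>: "\<Phi> \<in> bl_tensor m"
  shows "\<omega> \<in> space P \<Longrightarrow> integrable P' (\<lambda>\<omega>'. \<Phi> (X n \<omega>) (Z n (\<omega>, \<omega>')))"
    and "x \<in> mspace m \<Longrightarrow> integrable Q2 (\<lambda>t. \<Phi> x (\<xi>2 t))"
    and "integrable P (cond_mean \<Phi> n)"
    and "integrable P (\<lambda>\<omega>. limit_mean \<Phi> (X n \<omega>))"
    and "integrable Q1 (\<lambda>s. limit_mean \<Phi> (\<xi>1 s))"
proof -
  obtain C where C: "\<And>x z. x \<in> mspace m \<Longrightarrow> z \<in> mspace m \<Longrightarrow> \<bar>\<Phi> x z\<bar> \<le> C"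
    using bl_tensor_bounded[OF \<Phi>] by blast
  show "integrable P' (\<lambda>\<omega>'. \<Phi> (X n \<omega>) (Z n (\<omega>, \<omega>')))" if "\<omega> \<in> space P" for \<omega>
    using tensor_XZ_section_measurable[OF \<Phi> that] C[OF X_space Z_space] that
    by (intro P'.bounded_integrable) auto
  show "integrable Q2 (\<lambda>t. \<Phi> x (\<xi>2 t))" if "x \<in> mspace m" for x
    using tensor_\<xi>2_measurable[OF \<Phi> that] C[OF that \<xi>2_space]
    by (intro Q2.bounded_integrable) auto
  have lim: "\<bar>limit_mean \<Phi> x\<bar> \<le> C" if "x \<in> mspace m" for x
    unfolding limit_mean_def using tensor_\<xi>2_measurable[OF \<Phi> that] C[OF that \<xi>2_space]
    by (intro Q2.bounded_abs_integral_le) auto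
  have "\<bar>cond_mean \<Phi> n \<omega>\<bar> \<le> C" if "\<omega> \<in> space P" for \<omega>
    unfolding cond_mean_def
    using tensor_XZ_section_measurable[OF \<Phi> that] C[OF X_space Z_space] that
    by (intro P'.bounded_abs_integral_le) auto
  then show "integrable P (cond_mean \<Phi> n)"
    by (intro P.bounded_integrable cond_mean_measurable \<Phi>)
  show "integrable P (\<lambda>\<omega>. limit_mean \<Phi> (X n \<omega>))"
    by (rule P.bounded_integrable[OF limit_mean_X_measurable[OF \<Phi>] lim[OF X_space]])
  show "integrable Q1 (\<lambda>s. limit_mean \<Phi> (\<xi>1 s))"
    by (rule Q1.bounded_integrable[OF limit_mean_\<xi>1_measurable[OF \<Phi>] lim[OF \<xi>1_space]])
qed

text \<open>For an elementary product, \<open>A (X n \<omega>)\<close> leaves both inner integrals,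
  so the gap is at most a bound of \<open>A\<close> times the gap of \<open>B\<close> alone, which
  is the quantity in \<open>Z_lim\<close>. Sums follow by the triangle inequality.\<close>

lemma cond_mean_gap_tendsto:
  assumes "\<Phi> \<in> bl_tensor m"
  shows "(\<lambda>n. \<integral>\<omega>. \<bar>cond_mean \<Phi> n \<omega> - limit_mean \<Phi> (X n \<omega>)\<bar> \<partial>P) \<longlonglongrightarrow> 0"
  using assms
proof (induction \<Phi>)
  case (product A B)
  obtain C where C: "0 < C" "\<And>x. x \<in> mspace m \<Longrightarrow> \<bar>A x\<bar> \<le> C"
    by (rule bl_functionsE[OF product(1)]) iprover
  define h where "h n \<omega> = \<bar>(\<integral>\<omega>'. B (Z n (\<omega>, \<omega>')) \<partial>P') - (\<integral>t. B (\<xi>2 t) \<partial>Q2)\<bar>" for n \<omega>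
  \<comment> \<open>Writing \<open>B\<close> as a tensor with constant first factor gives the
    integrability of its gap from the general facts.\<close>
  have tens: "(\<lambda>x z. 1 * B z) \<in> bl_tensor m"
    by (intro bl_tensor.product bl_functions_const product)
  have h_eq: "h n \<omega> = \<bar>cond_mean (\<lambda>x z. 1 * B z) n \<omega> - limit_mean (\<lambda>x z. 1 * B z) (X n \<omega>)\<bar>" for n \<omega>
    unfolding h_def cond_mean_def limit_mean_def by simp
  have int_h: "integrable P (h n)" for n
    unfolding h_eq[abs_def] using tensor_integrable(3,4)[OF tens] by auto
  have "(\<lambda>n. C * (\<integral>\<omega>. h n \<omega> \<partial>P)) \<longlonglongrightarrow> C * 0"
    using Z_lim[OF product(2)] unfolding h_def by (intro tendsto_intros)
  then have lim: "(\<lambda>n. C * (\<integral>\<omega>. h n \<omega> \<partial>P)) \<longlonglongrightarrow> 0" by simp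
  have bound: "(\<integral>\<omega>. \<bar>cond_mean (\<lambda>x z. A x * B z) n \<omega> - limit_mean (\<lambda>x z. A x * B z) (X n \<omega>)\<bar> \<partial>P)
      \<le> C * (\<integral>\<omega>. h n \<omega> \<partial>P)" for n
  proof -
    have "\<bar>cond_mean (\<lambda>x z. A x * B z) n \<omega> - limit_mean (\<lambda>x z. A x * B z) (X n \<omega>)\<bar> \<le> C * h n \<omega>"
      if w: "\<omega> \<in> space P" for \<omega>
    proof -
      have "\<bar>cond_mean (\<lambda>x z. A x * B z) n \<omega> - limit_mean (\<lambda>x z. A x * B z) (X n \<omega>)\<bar>
          = \<bar>A (X n \<omega>)\<bar> * h n \<omega>"
        unfolding cond_mean_def limit_mean_def h_def by (simp add: abs_mult[symmetric] right_diff_distrib)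
      also have "\<dots> \<le> C * h n \<omega>"
        using C(2)[OF X_space[OF w]] by (intro mult_right_mono) (auto simp: h_def)
      finally show ?thesis .
    qed
    then have "(\<integral>\<omega>. \<bar>cond_mean (\<lambda>x z. A x * B z) n \<omega> - limit_mean (\<lambda>x z. A x * B z) (X n \<omega>)\<bar> \<partial>P)
        \<le> (\<integral>\<omega>. C * h n \<omega> \<partial>P)"
      using tensor_integrable(3,4)[OF bl_tensor.product[OF product]] int_h
      by (intro integral_mono) auto
    then show ?thesis by simp
  qed
  show ?case
    by (rule tendsto_sandwich[OF _ always_eventually[OF allI[OF bound]] tendsto_const lim]) simp
next
  case (add \<Phi> \<Psi>)
  have eq: "cond_mean (\<lambda>x z. \<Phi> x z + \<Psi> x z) n \<omega> = cond_mean \<Phi> n \<omega> + cond_mean \<Psi> n \<omega>"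
    "limit_mean (\<lambda>x z. \<Phi> x z + \<Psi> x z) (X n \<omega>) = limit_mean \<Phi> (X n \<omega>) + limit_mean \<Psi> (X n \<omega>)"
    if "\<omega> \<in> space P" for n \<omega>
    unfolding cond_mean_def limit_mean_def
    using tensor_integrable(1,2)[OF add.hyps(1)] tensor_integrable(1,2)[OF add.hyps(2)] that X_space
    by auto
  note int = tensor_integrable(3,4)[OF add.hyps(1)] tensor_integrable(3,4)[OF add.hyps(2)]
    tensor_integrable(3,4)[OF bl_tensor.add[OF add.hyps]]
  define S where "S \<Theta> n = (\<integral>\<omega>. \<bar>cond_mean \<Theta> n \<omega> - limit_mean \<Theta> (X n \<omega>)\<bar> \<partial>P)" for \<Theta> n
  have le: "S (\<lambda>x z. \<Phi> x z + \<Psi> x z) n \<le> S \<Phi> n + S \<Psi> n" for n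
  proof -
    have "S (\<lambda>x z. \<Phi> x z + \<Psi> x z) n \<le> (\<integral>\<omega>. \<bar>cond_mean \<Phi> n \<omega> - limit_mean \<Phi> (X n \<omega>)\<bar>
        + \<bar>cond_mean \<Psi> n \<omega> - limit_mean \<Psi> (X n \<omega>)\<bar> \<partial>P)"
      unfolding S_def using int by (intro integral_mono) (auto simp: eq)
    also have "\<dots> = S \<Phi> n + S \<Psi> n"
      unfolding S_def using int by (intro Bochner_Integration.integral_add) auto
    finally show ?thesis .
  qed
  have lim: "(\<lambda>n. S \<Phi> n + S \<Psi> n) \<longlonglongrightarrow> 0"
    using tendsto_add[OF add.IH] by (simp add: S_def)
  have nonneg: "0 \<le> S \<Theta> n" for \<Theta> n by (simp add: S_def)
  have "S (\<lambda>x z. \<Phi> x z + \<Psi> x z) \<longlonglongrightarrow> 0"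
    by (rule tendsto_sandwich[OF _ _ tendsto_const lim]) (simp_all add: le nonneg)
  then show ?case unfolding S_def .
qed

text \<open>For an elementary product the limit mean is \<open>A\<close> times a constant, so
  \<open>X_lim\<close> applies directly; linearity gives the rest.\<close>

lemma limit_mean_tendsto:
  assumes "\<Phi> \<in> bl_tensor m"
  shows "(\<lambda>n. \<integral>\<omega>. limit_mean \<Phi> (X n \<omega>) \<partial>P) \<longlonglongrightarrow> (\<integral>s. limit_mean \<Phi> (\<xi>1 s) \<partial>Q1)"
  using assms
proof (induction \<Phi>)
  case (product A B)
  have "limit_mean (\<lambda>x z. A x * B z) x = A x * (\<integral>t. B (\<xi>2 t) \<partial>Q2)" for x
    by (simp add: limit_mean_def)
  then show ?case using tendsto_mult_right[OF X_lim[OF product(1)]] by simp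
next
  case (add \<Phi> \<Psi>)
  have eq: "limit_mean (\<lambda>x z. \<Phi> x z + \<Psi> x z) x = limit_mean \<Phi> x + limit_mean \<Psi> x"
    if "x \<in> mspace m" for x
    unfolding limit_mean_def
    using tensor_integrable(2)[OF add.hyps(1)] tensor_integrable(2)[OF add.hyps(2)] that by auto
  have "(\<integral>\<omega>. limit_mean (\<lambda>x z. \<Phi> x z + \<Psi> x z) (X n \<omega>) \<partial>P)
      = (\<integral>\<omega>. limit_mean \<Phi> (X n \<omega>) \<partial>P) + (\<integral>\<omega>. limit_mean \<Psi> (X n \<omega>) \<partial>P)" for n
  proof -
    have "(\<integral>\<omega>. limit_mean (\<lambda>x z. \<Phi> x z + \<Psi> x z) (X n \<omega>) \<partial>P)
        = (\<integral>\<omega>. limit_mean \<Phi> (X n \<omega>) + limit_mean \<Psi> (X n \<omega>) \<partial>P)"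
      by (intro Bochner_Integration.integral_cong) (auto simp: eq X_space)
    then show ?thesis using tensor_integrable(4)[OF add.hyps(1)] tensor_integrable(4)[OF add.hyps(2)] by simp
  qed
  moreover have "(\<integral>s. limit_mean (\<lambda>x z. \<Phi> x z + \<Psi> x z) (\<xi>1 s) \<partial>Q1)
      = (\<integral>s. limit_mean \<Phi> (\<xi>1 s) \<partial>Q1) + (\<integral>s. limit_mean \<Psi> (\<xi>1 s) \<partial>Q1)"
  proof -
    have "(\<integral>s. limit_mean (\<lambda>x z. \<Phi> x z + \<Psi> x z) (\<xi>1 s) \<partial>Q1)
        = (\<integral>s. limit_mean \<Phi> (\<xi>1 s) + limit_mean \<Psi> (\<xi>1 s) \<partial>Q1)"
      by (intro Bochner_Integration.integral_cong) (auto simp: eq \<xi>1_space)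
    then show ?thesis using tensor_integrable(5)[OF add.hyps(1)] tensor_integrable(5)[OF add.hyps(2)] by simp
  qed
  ultimately show ?case using tendsto_add[OF add.IH] by simp
qed

text \<open>The hypothesis \<open>local\<close> replaces a continuous mapping on pairs: if \<open>X n\<close> is near \<open>y\<close> and \<open>Z n\<close> near
  \<open>z\<close>, then \<open>Y n\<close> is near \<open>K z\<close>. Almost all pairs are covered by finitely many such neighbourhoods,
  and a subordinate partition of unity made of products of bump functions reduces the whole
  distance to finitely many conditional means, uniformly over the test functions.\<close>

lemma dist_BL_dominated:
  fixes Y :: "nat \<Rightarrow> 'w \<times> 'v \<Rightarrow> 'e::{metric_space, second_countable_topology}" and K :: "'a \<Rightarrow> 'e"
  assumes Y: "\<And>n. Y n \<in> borel_measurable (P \<Otimes>\<^sub>M P')"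
    and K\<xi>2: "(\<lambda>t. K (\<xi>2 t)) \<in> borel_measurable Q2"
    and sep: "separable_space (subtopology (mtopology_of m) E0)" and sub: "E0 \<subseteq> mspace m"
    and \<xi>1E0: "\<And>s. s \<in> space Q1 \<Longrightarrow> \<xi>1 s \<in> E0" and \<xi>2E0: "\<And>t. t \<in> space Q2 \<Longrightarrow> \<xi>2 t \<in> E0"
    and K: "\<And>z e. z \<in> E0 \<Longrightarrow> 0 < e \<Longrightarrow> \<exists>r>0. \<forall>v\<in>E0. mdist m z v < r \<longrightarrow> dist (K v) (K z) < e"
    and local: "\<And>y z e. y \<in> E0 \<Longrightarrow> z \<in> E0 \<Longrightarrow> 0 < e \<Longrightarrow>
      \<exists>r>0. \<exists>N. \<forall>n\<ge>N. \<forall>\<omega>\<in>space P. \<forall>\<omega>'\<in>space P'.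
        mdist m y (X n \<omega>) < r \<longrightarrow> mdist m z (Z n (\<omega>, \<omega>')) < r \<longrightarrow> dist (Y n (\<omega>, \<omega>')) (K z) < e"
    and \<epsilon>: "0 < \<epsilon>"
  obtains R N L where "\<And>n. integrable P (R n)" "\<And>n \<omega>. \<omega> \<in> space P \<Longrightarrow> 0 \<le> R n \<omega>"
    "\<And>n \<omega>. N \<le> n \<Longrightarrow> \<omega> \<in> space P \<Longrightarrow> dist_BL_ball euclidean_metric
      (distr P' borel (\<lambda>\<omega>'. Y n (\<omega>, \<omega>'))) (distr Q2 borel (\<lambda>t. K (\<xi>2 t))) \<le> R n \<omega>"
    "(\<lambda>n. \<integral>\<omega>. R n \<omega> \<partial>P) \<longlonglongrightarrow> L" "L \<le> 4 * \<epsilon>"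
proof -
  \<comment> \<open>One radius has to serve for two comparisons with the same value
    \<open>K (snd p)\<close>: that of \<open>Y n\<close> near the pair, and that of \<open>K\<close>
    on \<open>E0\<close> near the second component.\<close>
  define good where "good p r N \<longleftrightarrow> 0 < r \<and>
      (\<forall>n\<ge>N. \<forall>\<omega>\<in>space P. \<forall>\<omega>'\<in>space P'. mdist m (fst p) (X n \<omega>) < r \<longrightarrow>
        mdist m (snd p) (Z n (\<omega>, \<omega>')) < r \<longrightarrow> dist (Y n (\<omega>, \<omega>')) (K (snd p)) < \<epsilon>) \<and>
      (\<forall>v\<in>E0. mdist m (snd p) v < r \<longrightarrow> dist (K v) (K (snd p)) < \<epsilon>)" for p r and N :: nat
  have "\<exists>r N. good p r N" if p: "p \<in> E0 \<times> E0" for p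
  proof -
    have "fst p \<in> E0" "snd p \<in> E0" using p by auto
    from local[OF this \<epsilon>] obtain r1 N where 1: "0 < r1" "\<forall>n\<ge>N. \<forall>\<omega>\<in>space P. \<forall>\<omega>'\<in>space P'.
        mdist m (fst p) (X n \<omega>) < r1 \<longrightarrow> mdist m (snd p) (Z n (\<omega>, \<omega>')) < r1 \<longrightarrow>
        dist (Y n (\<omega>, \<omega>')) (K (snd p)) < \<epsilon>" by blast
    from K[OF \<open>snd p \<in> E0\<close> \<epsilon>] obtain r2 where 2: "0 < r2"
      "\<forall>v\<in>E0. mdist m (snd p) v < r2 \<longrightarrow> dist (K v) (K (snd p)) < \<epsilon>" by blast
    have "good p (min r1 r2) N" unfolding good_def using 1 2 by simp
    then show ?thesis by blast
  qed
  then obtain r N where good: "\<And>p. p \<in> E0 \<times> E0 \<Longrightarrow> good p (r p) (N p)" by metis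
  have r_pos: "0 < r p" if "p \<in> E0 \<times> E0" for p using good[OF that] by (simp add: good_def)
  have "E0 \<noteq> {}" using Q1.not_empty \<xi>1E0 by blast
  \<comment> \<open>The cover uses half radii because the bumps equal 1 within half the radius and
    live within the full one.\<close>
  obtain c :: "nat \<Rightarrow> 'a \<times> 'a" where c: "\<And>i. c i \<in> E0 \<times> E0" "\<And>u v. u \<in> E0 \<Longrightarrow> v \<in> E0 \<Longrightarrow>
      \<exists>i. mdist m (fst (c i)) u < r (c i) / 2 \<and> mdist m (snd (c i)) v < r (c i) / 2"
    using separable_pair_cover[of m E0 "\<lambda>p. r p / 2", OF sep sub \<open>E0 \<noteq> {}\<close> half_gt_zero[OF r_pos]] by blast
  have c_space: "fst (c i) \<in> mspace m" "snd (c i) \<in> mspace m" for i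
    using c(1)[of i] sub by auto
  have rc: "0 < r (c i) / 2" for i using r_pos[OF c(1)] by simp
  define \<phi> where "\<phi> i x z = bump m (fst (c i)) (r (c i) / 2) x * bump m (snd (c i)) (r (c i) / 2) z" for i x z
  \<comment> \<open>\<open>rest k\<close> is the weight untouched by the first \<open>k\<close>
    bumps, and \<open>\<psi> j\<close> is what \<open>\<phi> j\<close> takes from the weight left by
    its predecessors; the sum of the \<open>\<psi> j\<close> therefore telescopes.\<close>
  define rest where "rest k x z = (\<Prod>i<k. 1 - \<phi> i x z)" for k x z
  define \<psi> where "\<psi> j x z = \<phi> j x z * rest j x z" for j x z
  have \<phi>_tensor: "\<phi> i \<in> bl_tensor m" for i
    unfolding \<phi>_def[abs_def] by (intro bl_tensor.product bump_bl_functions c_space rc)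
  have rest_tensor: "rest k \<in> bl_tensor m" for k
    unfolding rest_def[abs_def] by (intro bl_tensor_prod bl_tensor_diff bl_tensor_const \<phi>_tensor)
  have \<psi>_tensor: "\<psi> j \<in> bl_tensor m" for j
    unfolding \<psi>_def[abs_def] by (intro bl_tensor_mult \<phi>_tensor rest_tensor)
  have \<phi>01: "0 \<le> \<phi> i x z" "\<phi> i x z \<le> 1" for i x z
    unfolding \<phi>_def by (auto intro!: mult_nonneg_nonneg mult_le_one bump_nonneg bump_le_1)
  have rest01: "0 \<le> rest k x z" "rest k x z \<le> 1" for k x z
    unfolding rest_def using \<phi>01 by (auto intro!: prod_nonneg prod_le_1)
  have \<psi>_nonneg: "0 \<le> \<psi> j x z" for j x z
    unfolding \<psi>_def using \<phi>01 rest01 by simp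
  have sum_\<psi>: "(\<Sum>j<k. \<psi> j x z) = 1 - rest k x z" for k x z
    by (induction k) (auto simp: \<psi>_def rest_def algebra_simps)
  have \<psi>_pos: "mdist m (fst (c j)) x < r (c j)" "mdist m (snd (c j)) z < r (c j)"
    if "0 < \<psi> j x z" for j x z
  proof -
    have "\<phi> j x z \<noteq> 0" using that unfolding \<psi>_def by auto
    then have "0 < bump m (fst (c j)) (r (c j) / 2) x" "0 < bump m (snd (c j)) (r (c j) / 2) z"
      unfolding \<phi>_def using bump_nonneg[of m "fst (c j)" "r (c j) / 2" x]
        bump_nonneg[of m "snd (c j)" "r (c j) / 2" z] by auto
    from bump_pos_imp[OF rc this(1)] bump_pos_imp[OF rc this(2)]
    show "mdist m (fst (c j)) x < r (c j)" "mdist m (snd (c j)) z < r (c j)" by auto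
  qed
  have rest_lim: "(\<lambda>k. rest k u v) \<longlonglongrightarrow> 0" if uv: "u \<in> E0" "v \<in> E0" for u v
  proof -
    obtain i where "mdist m (fst (c i)) u < r (c i) / 2" "mdist m (snd (c i)) v < r (c i) / 2"
      using c(2)[OF uv] by blast
    then have "\<phi> i u v = 1" unfolding \<phi>_def by (simp add: bump_eq_1[OF rc])
    \<comment> \<open>Once the index \<open>i\<close> is included, its factor is
      \<open>1 - 1\<close>, so the leftover vanishes exactly on
      \<open>E0 \<times> E0\<close>.\<close>
    then have "rest k u v = 0" if "Suc i \<le> k" for k
      unfolding rest_def using that by (intro prod_zero) (auto intro!: bexI[of _ i])
    then show ?thesis
      by (intro tendsto_eventually) (auto simp: eventually_sequentially intro!: exI[of _ "Suc i"])
  qed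
  have lim_inner: "(\<lambda>k. limit_mean (rest k) (\<xi>1 s)) \<longlonglongrightarrow> 0" if s: "s \<in> space Q1" for s
  proof -
    have "(\<lambda>k. \<integral>t. rest k (\<xi>1 s) (\<xi>2 t) \<partial>Q2) \<longlonglongrightarrow> (\<integral>t. 0 \<partial>Q2)"
      using rest_lim[OF \<xi>1E0[OF s] \<xi>2E0] rest01 tensor_\<xi>2_measurable[OF rest_tensor \<xi>1_space[OF s]]
      by (intro integral_dominated_convergence[where w="\<lambda>_. 1"]) auto
    then show ?thesis by (simp add: limit_mean_def)
  qed
  have limit_mean_rest01: "0 \<le> limit_mean (rest k) x" "x \<in> mspace m \<Longrightarrow> limit_mean (rest k) x \<le> 1" for k x
  proof -
    show "0 \<le> limit_mean (rest k) x"
      unfolding limit_mean_def using rest01 by simp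
    assume "x \<in> mspace m"
    then show "limit_mean (rest k) x \<le> 1"
      unfolding limit_mean_def using rest01 tensor_integrable(2)[OF rest_tensor]
      by (intro Q2.integral_le_const) auto
  qed
  \<comment> \<open>Dominated convergence, used for the inner and now for the outer integral, fixes
    the number \<open>k\<close> of pieces using the limit laws alone.\<close>
  have "(\<lambda>k. \<integral>s. limit_mean (rest k) (\<xi>1 s) \<partial>Q1) \<longlonglongrightarrow> (\<integral>s. 0 \<partial>Q1)"
    using lim_inner limit_mean_rest01(1) limit_mean_rest01(2)[OF \<xi>1_space] limit_mean_\<xi>1_measurable[OF rest_tensor]
    by (intro integral_dominated_convergence[where w="\<lambda>_. 1"]) auto
  then have "eventually (\<lambda>k. (\<integral>s. limit_mean (rest k) (\<xi>1 s) \<partial>Q1) < \<epsilon>) sequentially"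
    using order_tendstoD(2) \<epsilon> by fastforce
  then obtain k where k: "(\<integral>s. limit_mean (rest k) (\<xi>1 s) \<partial>Q1) < \<epsilon>"
    by (meson eventually_happens' sequentially_bot)
  define gap where "gap j n \<omega> = \<bar>cond_mean (\<psi> j) n \<omega> - limit_mean (\<psi> j) (X n \<omega>)\<bar>" for j n \<omega>
  \<comment> \<open>Each of the two partition estimates costs \<open>\<epsilon>\<close> and one
    leftover mean. The gaps enter once when the finite sums are compared and once more when the
    conditional leftover is replaced by the limiting one.\<close>
  define R where "R n \<omega> = 2 * \<epsilon> + 2 * (\<Sum>j<k. gap j n \<omega>) + 2 * limit_mean (rest k) (X n \<omega>)" for n \<omega>
  have gap_int: "integrable P (gap j n)" for j n
    unfolding gap_def[abs_def] using tensor_integrable(3,4)[OF \<psi>_tensor] by auto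
  have R_int: "integrable P (R n)" for n
    unfolding R_def[abs_def] using gap_int tensor_integrable(4)[OF rest_tensor] by auto
  have R_nonneg: "0 \<le> R n \<omega>" if "\<omega> \<in> space P" for n \<omega>
    unfolding R_def using \<epsilon> limit_mean_rest01(1) by (auto intro!: add_nonneg_nonneg sum_nonneg simp: gap_def)
  have R_lim: "(\<lambda>n. \<integral>\<omega>. R n \<omega> \<partial>P) \<longlonglongrightarrow> 2 * \<epsilon> + 2 * (\<integral>s. limit_mean (rest k) (\<xi>1 s) \<partial>Q1)"
  proof -
    have "(\<integral>\<omega>. R n \<omega> \<partial>P) = 2 * \<epsilon> + 2 * (\<Sum>j<k. \<integral>\<omega>. gap j n \<omega> \<partial>P)
        + 2 * (\<integral>\<omega>. limit_mean (rest k) (X n \<omega>) \<partial>P)" for n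
      unfolding R_def using gap_int tensor_integrable(4)[OF rest_tensor] by (simp add: P.prob_space)
    moreover have "(\<lambda>n. 2 * \<epsilon> + 2 * (\<Sum>j<k. \<integral>\<omega>. gap j n \<omega> \<partial>P)
        + 2 * (\<integral>\<omega>. limit_mean (rest k) (X n \<omega>) \<partial>P))
        \<longlonglongrightarrow> 2 * \<epsilon> + 2 * (\<Sum>j<k. 0) + 2 * (\<integral>s. limit_mean (rest k) (\<xi>1 s) \<partial>Q1)"
      unfolding gap_def using cond_mean_gap_tendsto[OF \<psi>_tensor] limit_mean_tendsto[OF rest_tensor]
      by (intro tendsto_intros)
    ultimately show ?thesis by simp
  qed
  \<comment> \<open>The sum serves as a common upper bound of the finitely many thresholds.\<close>
  define N0 where "N0 = (\<Sum>j<k. N (c j))"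
  have N0: "N (c j) \<le> N0" if "j < k" for j
    unfolding N0_def using that by (intro member_le_sum) auto
  have bound: "dist_BL_ball euclidean_metric (distr P' borel (\<lambda>\<omega>'. Y n (\<omega>, \<omega>')))
      (distr Q2 borel (\<lambda>t. K (\<xi>2 t))) \<le> R n \<omega>" if n: "N0 \<le> n" and w: "\<omega> \<in> space P" for n \<omega>
    unfolding dist_BL_ball_def
  proof (rule cSUP_least)
    show "BL1_ball euclidean_metric \<noteq> ({} :: ('e \<Rightarrow> real) set)" using BL1_ball_zero by blast
    fix u :: "'e \<Rightarrow> real" assume u: "u \<in> BL1_ball euclidean_metric"
    have u_meas [measurable]: "u \<in> borel_measurable borel"
      using BL1_ballD(1)[OF u] by (simp add: ball_algebra_euclidean)
    have u1: "\<bar>u y\<bar> \<le> 1" for y using BL1_ballD(2)[OF u] by simp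
    have u_lip: "\<bar>u y - u y'\<bar> \<le> dist y y'" for y y' using BL1_ballD(3)[OF u] by simp
    \<comment> \<open>The test function enters the comparison only through these coefficients; as
      they are bounded by 1, the bound \<open>R\<close> does not depend on \<open>u\<close>.\<close>
    define a where "a j = u (K (snd (c j)))" for j
    have Y_meas [measurable]: "(\<lambda>\<omega>'. Y n (\<omega>, \<omega>')) \<in> borel_measurable P'"
      using measurable_compose[OF measurable_Pair1'[OF w] Y] .
    note x = X_space[OF w, of n]
    have 1: "\<bar>(\<integral>\<omega>'. u (Y n (\<omega>, \<omega>')) \<partial>P') - (\<Sum>j<k. a j * cond_mean (\<psi> j) n \<omega>)\<bar>
        \<le> cond_mean (rest k) n \<omega> + \<epsilon>"
      unfolding cond_mean_def
    proof (rule P'.partition_of_unity_integral_estimate)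
      show "integrable P' (\<lambda>\<omega>'. u (Y n (\<omega>, \<omega>')))"
        using u1 by (intro P'.bounded_integrable) auto
      fix \<omega>' assume w': "\<omega>' \<in> space P'"
      show "\<bar>u (Y n (\<omega>, \<omega>')) - (\<Sum>j<k. a j * \<psi> j (X n \<omega>) (Z n (\<omega>, \<omega>')))\<bar>
          \<le> rest k (X n \<omega>) (Z n (\<omega>, \<omega>')) + \<epsilon>"
      proof (rule partition_of_unity_estimate)
        fix j assume j: "j < k" and pos: "0 < \<psi> j (X n \<omega>) (Z n (\<omega>, \<omega>'))"
        have "dist (Y n (\<omega>, \<omega>')) (K (snd (c j))) < \<epsilon>"
          using good[OF c(1), of j] \<psi>_pos[OF pos] w w' N0[OF j] n unfolding good_def by auto
        then show "\<bar>u (Y n (\<omega>, \<omega>')) - a j\<bar> \<le> \<epsilon>"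
          unfolding a_def using u_lip[of "Y n (\<omega>, \<omega>')" "K (snd (c j))"] by linarith
      qed (use sum_\<psi> \<psi>_nonneg rest01 u1 \<epsilon> in auto)
    qed (use tensor_integrable(1)[OF \<psi>_tensor w] tensor_integrable(1)[OF rest_tensor w] in auto)
    have 2: "\<bar>(\<integral>t. u (K (\<xi>2 t)) \<partial>Q2) - (\<Sum>j<k. a j * limit_mean (\<psi> j) (X n \<omega>))\<bar>
        \<le> limit_mean (rest k) (X n \<omega>) + \<epsilon>"
      unfolding limit_mean_def
    proof (rule Q2.partition_of_unity_integral_estimate)
      show "integrable Q2 (\<lambda>t. u (K (\<xi>2 t)))"
        using u1 K\<xi>2 by (intro Q2.bounded_integrable) auto
      fix t assume t: "t \<in> space Q2"
      show "\<bar>u (K (\<xi>2 t)) - (\<Sum>j<k. a j * \<psi> j (X n \<omega>) (\<xi>2 t))\<bar> \<le> rest k (X n \<omega>) (\<xi>2 t) + \<epsilon>"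
      proof (rule partition_of_unity_estimate)
        fix j assume j: "j < k" and pos: "0 < \<psi> j (X n \<omega>) (\<xi>2 t)"
        have "dist (K (\<xi>2 t)) (K (snd (c j))) < \<epsilon>"
          using good[OF c(1), of j] \<psi>_pos[OF pos] \<xi>2E0[OF t] unfolding good_def by auto
        then show "\<bar>u (K (\<xi>2 t)) - a j\<bar> \<le> \<epsilon>"
          unfolding a_def using u_lip[of "K (\<xi>2 t)" "K (snd (c j))"] by linarith
      qed (use sum_\<psi> \<psi>_nonneg rest01 u1 \<epsilon> in auto)
    qed (use tensor_integrable(2)[OF \<psi>_tensor x] tensor_integrable(2)[OF rest_tensor x] in auto)
    have "\<bar>(\<Sum>j<k. a j * cond_mean (\<psi> j) n \<omega>) - (\<Sum>j<k. a j * limit_mean (\<psi> j) (X n \<omega>))\<bar>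
        = \<bar>\<Sum>j<k. a j * (cond_mean (\<psi> j) n \<omega> - limit_mean (\<psi> j) (X n \<omega>))\<bar>"
      by (simp add: sum_subtractf right_diff_distrib)
    also have "\<dots> \<le> (\<Sum>j<k. gap j n \<omega>)"
    proof (rule order_trans[OF sum_abs sum_mono])
      fix j
      have "\<bar>a j\<bar> * gap j n \<omega> \<le> 1 * gap j n \<omega>"
        using u1 by (intro mult_right_mono) (auto simp: a_def gap_def)
      then show "\<bar>a j * (cond_mean (\<psi> j) n \<omega> - limit_mean (\<psi> j) (X n \<omega>))\<bar> \<le> gap j n \<omega>"
        by (simp add: gap_def abs_mult)
    qed
    finally have 3: "\<bar>(\<Sum>j<k. a j * cond_mean (\<psi> j) n \<omega>) - (\<Sum>j<k. a j * limit_mean (\<psi> j) (X n \<omega>))\<bar>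
        \<le> (\<Sum>j<k. gap j n \<omega>)" .
    \<comment> \<open>The leftover is 1 minus the sum of the pieces, so its conditional mean is
      controlled by the gaps of the \<open>\<psi> j\<close> without a gap term of its own.\<close>
    have 4: "cond_mean (rest k) n \<omega> \<le> limit_mean (rest k) (X n \<omega>) + (\<Sum>j<k. gap j n \<omega>)"
    proof -
      have "cond_mean (rest k) n \<omega> = (\<integral>\<omega>'. 1 - (\<Sum>j<k. \<psi> j (X n \<omega>) (Z n (\<omega>, \<omega>'))) \<partial>P')"
        unfolding cond_mean_def sum_\<psi> by simp
      also have "\<dots> = 1 - (\<Sum>j<k. cond_mean (\<psi> j) n \<omega>)"
        unfolding cond_mean_def using tensor_integrable(1)[OF \<psi>_tensor w] by (simp add: P'.prob_space)
      finally have c1: "cond_mean (rest k) n \<omega> = 1 - (\<Sum>j<k. cond_mean (\<psi> j) n \<omega>)" .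
      have "limit_mean (rest k) (X n \<omega>) = (\<integral>t. 1 - (\<Sum>j<k. \<psi> j (X n \<omega>) (\<xi>2 t)) \<partial>Q2)"
        unfolding limit_mean_def sum_\<psi> by simp
      also have "\<dots> = 1 - (\<Sum>j<k. limit_mean (\<psi> j) (X n \<omega>))"
        unfolding limit_mean_def using tensor_integrable(2)[OF \<psi>_tensor x] by (simp add: Q2.prob_space)
      finally have c2: "limit_mean (rest k) (X n \<omega>) = 1 - (\<Sum>j<k. limit_mean (\<psi> j) (X n \<omega>))" .
      have "cond_mean (rest k) n \<omega> - limit_mean (rest k) (X n \<omega>)
          = (\<Sum>j<k. limit_mean (\<psi> j) (X n \<omega>) - cond_mean (\<psi> j) n \<omega>)"
        unfolding c1 c2 by (simp add: sum_subtractf)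
      also have "\<dots> \<le> (\<Sum>j<k. gap j n \<omega>)"
        by (rule sum_mono) (simp add: gap_def)
      finally show ?thesis by linarith
    qed
    have "\<bar>(\<integral>\<omega>'. u (Y n (\<omega>, \<omega>')) \<partial>P') - (\<integral>t. u (K (\<xi>2 t)) \<partial>Q2)\<bar> \<le> R n \<omega>"
      using 1 2 3 4 unfolding R_def by linarith
    then show "\<bar>(\<integral>y. u y \<partial>distr P' borel (\<lambda>\<omega>'. Y n (\<omega>, \<omega>')))
        - (\<integral>y. u y \<partial>distr Q2 borel (\<lambda>t. K (\<xi>2 t)))\<bar> \<le> R n \<omega>"
      using K\<xi>2 by (simp add: integral_distr)
  qed
  show thesis
    by (rule that[OF R_int R_nonneg bound R_lim]) (use k in auto)
qed

theorem dist_BL_tendsto_in_probability: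
  fixes Y :: "nat \<Rightarrow> 'w \<times> 'v \<Rightarrow> 'e::{metric_space, second_countable_topology}" and K :: "'a \<Rightarrow> 'e"
  assumes Y: "\<And>n. Y n \<in> borel_measurable (P \<Otimes>\<^sub>M P')"
    and sep: "separable_space (subtopology (mtopology_of m) E0)" and sub: "E0 \<subseteq> mspace m"
    and \<xi>1E0: "\<And>s. s \<in> space Q1 \<Longrightarrow> \<xi>1 s \<in> E0" and \<xi>2E0: "\<And>t. t \<in> space Q2 \<Longrightarrow> \<xi>2 t \<in> E0"
    and K: "\<And>z e. z \<in> E0 \<Longrightarrow> 0 < e \<Longrightarrow> \<exists>r>0. \<forall>v\<in>E0. mdist m z v < r \<longrightarrow> dist (K v) (K z) < e"
    and local: "\<And>y z e. y \<in> E0 \<Longrightarrow> z \<in> E0 \<Longrightarrow> 0 < e \<Longrightarrow>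
      \<exists>r>0. \<exists>N. \<forall>n\<ge>N. \<forall>\<omega>\<in>space P. \<forall>\<omega>'\<in>space P'.
        mdist m y (X n \<omega>) < r \<longrightarrow> mdist m z (Z n (\<omega>, \<omega>')) < r \<longrightarrow> dist (Y n (\<omega>, \<omega>')) (K z) < e"
    and \<delta>: "0 < \<delta>"
  defines "bad \<equiv> \<lambda>n. {\<omega> \<in> space P. \<delta> \<le> dist_BL_ball euclidean_metric
      (distr P' borel (\<lambda>\<omega>'. Y n (\<omega>, \<omega>'))) (distr Q2 borel (\<lambda>t. K (\<xi>2 t)))}"
  shows "bad n \<in> sets P" and "(\<lambda>n. measure P (bad n)) \<longlonglongrightarrow> 0"
proof -
  have K\<xi>2: "(\<lambda>t. K (\<xi>2 t)) \<in> borel_measurable Q2"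
    by (rule continuous_on_separable_measurable[OF sep sub \<xi>2_meas \<xi>2E0 K])
  have [measurable]: "(\<lambda>\<omega>. dist_BL_ball euclidean_metric (distr P' borel (\<lambda>\<omega>'. Y n (\<omega>, \<omega>')))
      (distr Q2 borel (\<lambda>t. K (\<xi>2 t)))) \<in> borel_measurable P" for n
    by (rule dist_BL_kernel_measurable[OF P'.prob_space_axioms Y Q2.prob_space_axioms K\<xi>2])
  show bad_sets: "bad n \<in> sets P" for n unfolding bad_def by measurable
  show "(\<lambda>n. measure P (bad n)) \<longlonglongrightarrow> 0"
  proof (rule LIMSEQ_I)
    fix \<eta> :: real assume \<eta>: "0 < \<eta>"
    \<comment> \<open>The limit of the means is then at most \<open>\<delta> * \<eta> / 2\<close>,
      strictly below the value \<open>\<delta> * \<eta>\<close> that Markov's inequality at level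
      \<open>\<delta>\<close> requires.\<close>
    define \<epsilon> where "\<epsilon> = \<delta> * \<eta> / 8"
    have \<epsilon>: "0 < \<epsilon>" unfolding \<epsilon>_def using \<delta> \<eta> by simp
    show "\<exists>no. \<forall>n\<ge>no. norm (measure P (bad n) - 0) < \<eta>"
    proof (rule dist_BL_dominated[OF Y K\<xi>2 sep sub \<xi>1E0 \<xi>2E0 K local \<epsilon>])
      fix R N L
      assume R: "\<And>n. integrable P (R n)" "\<And>n \<omega>. \<omega> \<in> space P \<Longrightarrow> 0 \<le> R n \<omega>"
        "\<And>n \<omega>. N \<le> n \<Longrightarrow> \<omega> \<in> space P \<Longrightarrow> dist_BL_ball euclidean_metric
          (distr P' borel (\<lambda>\<omega>'. Y n (\<omega>, \<omega>'))) (distr Q2 borel (\<lambda>t. K (\<xi>2 t))) \<le> R n \<omega>"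
        "(\<lambda>n. \<integral>\<omega>. R n \<omega> \<partial>P) \<longlonglongrightarrow> L" "L \<le> 4 * \<epsilon>"
      have "L < \<delta> * \<eta>" using R(5) mult_pos_pos[OF \<delta> \<eta>] unfolding \<epsilon>_def by simp
      then obtain M where M: "\<And>n. M \<le> n \<Longrightarrow> (\<integral>\<omega>. R n \<omega> \<partial>P) < \<delta> * \<eta>"
        using order_tendstoD(2)[OF R(4)] unfolding eventually_sequentially by blast
      have "norm (measure P (bad n) - 0) < \<eta>" if n: "max M N \<le> n" for n
      proof -
        have [measurable]: "R n \<in> borel_measurable P" using R(1)[of n] by auto
        have "bad n \<subseteq> {\<omega> \<in> space P. \<delta> \<le> R n \<omega>}" unfolding bad_def using R(3)[of n] n by fastforce
        then have "measure P (bad n) \<le> measure P {\<omega> \<in> space P. \<delta> \<le> R n \<omega>}"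
          by (intro P.finite_measure_mono) auto
        also have "\<dots> \<le> (\<integral>\<omega>. R n \<omega> \<partial>P) / \<delta>"
          using R(1,2) \<delta> by (intro integral_Markov_inequality_measure[where A="{}"]) auto
        also have "\<dots> < \<eta>" using M[of n] n \<delta> by (simp add: divide_less_eq mult.commute)
        finally show ?thesis by simp
      qed
      then show ?thesis by blast
    qed
  qed
qed

end

section \<open>Mapping theorem and convergence modes\<close>

lemma conv_in_distr_ball_Cb_iff:
  assumes "\<And>n. X n \<in> measurable (M n) (ball_algebra m)" "X0 \<in> measurable M0 (ball_algebra m)"
  shows "conv_in_distr_ball m M X M0 X0 \<longleftrightarrow>
    (\<forall>g\<in>Cb_ball m. (\<lambda>n. \<integral>w. g (X n w) \<partial>M n) \<longlonglongrightarrow> (\<integral>z. g (X0 z) \<partial>M0))"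
proof -
  have "g \<in> borel_measurable (ball_algebra m)" if "g \<in> Cb_ball m" for g
    using that by (simp add: Cb_ball_def)
  then show ?thesis
    unfolding conv_in_distr_ball_def weak_conv_ball_def
    by (intro ball_cong refl) (simp add: integral_distr[OF assms(1)] integral_distr[OF assms(2)])
qed

lemma continuous_map_metric_localD:
  fixes K :: "'a \<Rightarrow> 'e::metric_space"
  assumes cont: "continuous_map (subtopology (mtopology_of m) E0) euclidean K" and sub: "E0 \<subseteq> mspace m"
    and z: "z \<in> E0" and e: "0 < e"
  shows "\<exists>r>0. \<forall>v\<in>E0. mdist m z v < r \<longrightarrow> dist (K v) (K z) < e"
proof -
  have top: "topspace (subtopology (mtopology_of m) E0) = E0" using sub by auto
  have "openin (subtopology (mtopology_of m) E0) {x \<in> E0. K x \<in> ball (K z) e}"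
    using openin_continuous_map_preimage[OF cont, of "ball (K z) e"] unfolding top by simp
  then obtain U where U: "openin (mtopology_of m) U" "{x \<in> E0. K x \<in> ball (K z) e} = U \<inter> E0"
    unfolding openin_subtopology by blast
  have "z \<in> {x \<in> E0. K x \<in> ball (K z) e}" using z e by simp
  then have "z \<in> U" unfolding U(2) by simp
  then obtain r where r: "0 < r" "Metric_space.mball (mspace m) (mdist m) z r \<subseteq> U"
    using U(1)[unfolded mtopology_of_def Metric_space.openin_mtopology[OF Metric_space_mspace_mdist]]
    by auto
  have "dist (K v) (K z) < e" if v: "v \<in> E0" "mdist m z v < r" for v
  proof -
    have "v \<in> Metric_space.mball (mspace m) (mdist m) z r"
      using v z sub by (simp add: Metric_space.in_mball[OF Metric_space_mspace_mdist] subset_iff)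
    then have "v \<in> U" using r(2) by blast
    then have "v \<in> {x \<in> E0. K x \<in> ball (K z) e}" unfolding U(2) using v(1) by simp
    then show ?thesis by (simp add: dist_commute)
  qed
  then show ?thesis using r(1) by blast
qed

text \<open>\<open>Y n\<close> need not be a function of \<open>X n\<close>; it only has to be close
  to \<open>K z\<close> whenever \<open>n\<close> is large and \<open>X n\<close> is near
  \<open>z\<close>. This form suits maps that vary with \<open>n\<close>, such as difference
  quotients.\<close>

lemma extended_continuous_mapping:
  fixes Y :: "nat \<Rightarrow> 'w \<Rightarrow> 'e::{metric_space, second_countable_topology}" and K :: "'a \<Rightarrow> 'e"
  assumes P: "prob_space P" and P0: "prob_space P0"
    and X [measurable]: "\<And>n. X n \<in> measurable P (ball_algebra m)"
    and \<xi> [measurable]: "\<xi> \<in> measurable P0 (ball_algebra m)"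
    and conv: "conv_in_distr_ball m (\<lambda>n. P) X P0 \<xi>"
    and sep: "separable_space (subtopology (mtopology_of m) E0)" and sub: "E0 \<subseteq> mspace m"
    and \<xi>E0: "\<And>t. t \<in> space P0 \<Longrightarrow> \<xi> t \<in> E0"
    and Y [measurable]: "\<And>n. Y n \<in> borel_measurable P"
    and K: "continuous_map (subtopology (mtopology_of m) E0) euclidean K"
    and local: "\<And>z e. z \<in> E0 \<Longrightarrow> 0 < e \<Longrightarrow> \<exists>r>0. \<exists>N. \<forall>n\<ge>N. \<forall>\<omega>\<in>space P.
      mdist m z (X n \<omega>) < r \<longrightarrow> dist (Y n \<omega>) (K z) < e"
  shows "conv_in_distr_ball euclidean_metric (\<lambda>n. P) Y P0 (\<lambda>t. K (\<xi> t))"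
proof -
  interpret P: prob_space P by fact
  interpret P0: prob_space P0 by fact
  have K_local: "\<exists>r>0. \<forall>v\<in>E0. mdist m z v < r \<longrightarrow> dist (K v) (K z) < e" if "z \<in> E0" "0 < e" for z e
    by (rule continuous_map_metric_localD[OF K sub that])
  have K\<xi> [measurable]: "(\<lambda>t. K (\<xi> t)) \<in> borel_measurable P0"
    by (rule continuous_on_separable_measurable[OF sep sub \<xi> \<xi>E0 K_local])
  \<comment> \<open>The unconditional statement is the conditional one over a one-point space.\<close>
  obtain x0 where x0: "x0 \<in> E0" using P0.not_empty \<xi>E0 by blast
  define U where "U = return (count_space UNIV) ()"
  have U: "prob_space U" "space U = UNIV" "sets U = UNIV"
    unfolding U_def by (auto intro: prob_space_return)
  have \<xi>_lim: "(\<lambda>n. \<integral>\<omega>. B (X n \<omega>) \<partial>P) \<longlonglongrightarrow> (\<integral>t. B (\<xi> t) \<partial>P0)" if "B \<in> bl_functions m" for B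
    using conv bl_functions_subset_Cb that
    unfolding conv_in_distr_ball_Cb_iff[of X "\<lambda>n. P", OF X \<xi>] by blast
  have U_integral: "(\<integral>u. h u \<partial>U) = h ()" for h :: "unit \<Rightarrow> real"
    unfolding U_def by (subst integral_return) auto
  have x0_meas: "(\<lambda>u. x0) \<in> measurable U (ball_algebra m)"
    using x0 sub by (auto simp: space_ball_algebra)
  have X_snd: "(\<lambda>p. X n (snd p)) \<in> measurable (U \<Otimes>\<^sub>M P) (ball_algebra m)" for n
    by measurable
  have const_lim: "(\<lambda>n. \<integral>u. A x0 \<partial>U) \<longlonglongrightarrow> (\<integral>u. A x0 \<partial>U)" for A :: "'a \<Rightarrow> real"
    by simp
  have \<xi>_L1: "(\<lambda>n. \<integral>u. \<bar>(\<integral>\<omega>'. B (X n (snd (u, \<omega>'))) \<partial>P) - (\<integral>t. B (\<xi> t) \<partial>P0)\<bar> \<partial>U) \<longlonglongrightarrow> 0"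
    if "B \<in> bl_functions m" for B
    unfolding U_integral using \<xi>_lim[OF that] by (simp add: LIM_zero tendsto_rabs_zero)
  interpret cbl: conditional_bl_convergence U P U P0 m "\<lambda>n u. x0" "\<lambda>n p. X n (snd p)" "\<lambda>u. x0" \<xi>
    by (intro conditional_bl_convergence.intro conditional_bl_convergence_axioms.intro)
      ((rule U(1) P P0 x0_meas X_snd \<xi>) | (erule \<xi>_L1) | (rule const_lim))+
  show ?thesis
    unfolding conv_in_distr_ball_Cb_iff[of Y "\<lambda>n. P" euclidean_metric, unfolded ball_algebra_euclidean, OF Y K\<xi>]
  proof
    fix g :: "'e \<Rightarrow> real" assume g: "g \<in> Cb_ball euclidean_metric"
    obtain C0 where C0: "\<And>x. \<bar>g x\<bar> \<le> C0" using g unfolding Cb_ball_def by auto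
    define C where "C = max C0 1"
    have C: "0 < C" "\<And>x. \<bar>g x\<bar> \<le> C" using C0 unfolding C_def by (auto simp: le_max_iff_disj)
    have g_cont: "continuous_on UNIV g" using g unfolding Cb_ball_def by simp
    have [measurable]: "g \<in> borel_measurable borel"
      using g by (simp add: Cb_ball_def ball_algebra_euclidean)
    \<comment> \<open>After scaling to [-1, 1] the distance theorem is applied to the real variables
      \<open>G (Y n \<omega>)\<close>, for which a truncated identity is a bounded Lipschitz test
      function. Continuity of \<open>g\<close> is thus enough, and no Lipschitz approximation of it
      is needed.\<close>
    define G where "G y = g y / C" for y
    have G_cont: "continuous_on UNIV G" unfolding G_def using g_cont C(1) by (intro continuous_intros) auto
    have G_near: "\<exists>d>0. \<forall>y'. dist y' y < d \<longrightarrow> dist (G y') (G y) < e" if "0 < e" for y e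
      using G_cont that unfolding continuous_on_iff by auto
    have [measurable]: "G \<in> borel_measurable borel" unfolding G_def[abs_def] by measurable
    have G1: "\<bar>G y\<bar> \<le> 1" for y unfolding G_def using C(1) C(2)[of y] by simp
    have lim: "(\<lambda>n. \<integral>\<omega>. G (Y n \<omega>) \<partial>P) \<longlonglongrightarrow> (\<integral>t. G (K (\<xi> t)) \<partial>P0)"
    proof (rule LIMSEQ_I)
      fix \<delta> :: real assume \<delta>: "0 < \<delta>"
      define d where "d n = dist_BL_ball euclidean_metric (distr P borel (\<lambda>\<omega>. G (Y n \<omega>)))
        (distr P0 borel (\<lambda>t. G (K (\<xi> t))))" for n
      have "(\<lambda>n. measure U {u \<in> space U. \<delta> \<le> dist_BL_ball euclidean_metric
        (distr P borel (\<lambda>\<omega>'. G (Y n (snd (u, \<omega>'))))) (distr P0 borel (\<lambda>t. G (K (\<xi> t))))}) \<longlonglongrightarrow> 0"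
      proof (rule cbl.dist_BL_tendsto_in_probability(2)[OF _ sep sub _ \<xi>E0 _ _ \<delta>])
        show "(\<lambda>p. G (Y n (snd p))) \<in> borel_measurable (U \<Otimes>\<^sub>M P)" for n by measurable
        show "x0 \<in> E0" by fact
        show "\<exists>r>0. \<forall>v\<in>E0. mdist m z v < r \<longrightarrow> dist (G (K v)) (G (K z)) < e"
          if "z \<in> E0" "0 < e" for z e
        proof -
          obtain d where "0 < d" "\<And>y'. dist y' (K z) < d \<Longrightarrow> dist (G y') (G (K z)) < e"
            using G_near[OF \<open>0 < e\<close>] by blast
          with K_local[OF \<open>z \<in> E0\<close> \<open>0 < d\<close>] show ?thesis by blast
        qed
        show "\<exists>r>0. \<exists>N. \<forall>n\<ge>N. \<forall>\<omega>\<in>space U. \<forall>\<omega>'\<in>space P. mdist m y x0 < r \<longrightarrow>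
            mdist m z (X n (snd (\<omega>, \<omega>'))) < r \<longrightarrow> dist (G (Y n (snd (\<omega>, \<omega>')))) (G (K z)) < e"
          if "y \<in> E0" "z \<in> E0" "0 < e" for y z e
        proof -
          obtain d where d: "0 < d" "\<And>y'. dist y' (K z) < d \<Longrightarrow> dist (G y') (G (K z)) < e"
            using G_near[OF \<open>0 < e\<close>] by blast
          obtain r N where "0 < r" "\<forall>n\<ge>N. \<forall>\<omega>\<in>space P. mdist m z (X n \<omega>) < r \<longrightarrow> dist (Y n \<omega>) (K z) < d"
            using local[OF \<open>z \<in> E0\<close> \<open>0 < d\<close>] by blast
          then show ?thesis using d(2) by (intro exI[of _ r] conjI exI[of _ N]) auto
        qed
      qed
      then have "(\<lambda>n. measure U {u \<in> space U. \<delta> \<le> d n}) \<longlonglongrightarrow> 0" by (simp add: d_def)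
      then have "eventually (\<lambda>n. measure U {u \<in> space U. \<delta> \<le> d n} < 1) sequentially"
        by (rule order_tendstoD) simp
      then obtain N where N: "\<And>n. N \<le> n \<Longrightarrow> measure U {u \<in> space U. \<delta> \<le> d n} < 1"
        unfolding eventually_sequentially by blast
      have "norm ((\<integral>\<omega>. G (Y n \<omega>) \<partial>P) - (\<integral>t. G (K (\<xi> t)) \<partial>P0)) < \<delta>" if n: "N \<le> n" for n
      proof -
        \<comment> \<open>\<open>d n\<close> does not depend on the point of \<open>U\<close>, so
          the bad set is empty or everything, and a measure below 1 excludes the latter.\<close>
        have "d n < \<delta>"
        proof (rule ccontr)
          assume "\<not> d n < \<delta>"
          then have "{u \<in> space U. \<delta> \<le> d n} = space U" by auto
          then show False using N[OF n] prob_space.prob_space[OF U(1)] by simp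
        qed
        define u :: "real \<Rightarrow> real" where "u y = max (-1) (min 1 y)" for y
        have "u \<in> borel_measurable borel" unfolding u_def[abs_def] by measurable
        then have u: "u \<in> BL1_ball euclidean_metric"
          unfolding BL1_ball_def by (auto simp: ball_algebra_euclidean u_def dist_real_def)
        have uG: "u (G y) = G y" for y using G1[of y] unfolding u_def by auto
        have "\<bar>(\<integral>\<omega>. u (G (Y n \<omega>)) \<partial>P) - (\<integral>t. u (G (K (\<xi> t))) \<partial>P0)\<bar> \<le> d n"
          unfolding d_def ball_algebra_euclidean[symmetric]
          by (rule BL1_ball_integral_diff_le_dist_BL[OF P _ P0 _ u]) (simp_all add: ball_algebra_euclidean)
        then show ?thesis using \<open>d n < \<delta>\<close> by (simp add: uG)
      qed
      then show "\<exists>no. \<forall>n\<ge>no. norm ((\<integral>\<omega>. G (Y n \<omega>) \<partial>P) - (\<integral>t. G (K (\<xi> t)) \<partial>P0)) < \<delta>" by blast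
    qed
    have "(\<lambda>n. C * (\<integral>\<omega>. G (Y n \<omega>) \<partial>P)) \<longlonglongrightarrow> C * (\<integral>t. G (K (\<xi> t)) \<partial>P0)"
      by (intro tendsto_intros lim)
    then show "(\<lambda>n. \<integral>\<omega>. g (Y n \<omega>) \<partial>P) \<longlonglongrightarrow> (\<integral>t. g (K (\<xi> t)) \<partial>P0)"
      using C(1) by (simp add: G_def)
  qed
qed

text \<open>At almost every \<open>\<omega>\<close> the weak convergence can be tested on
  \<open>B\<close>; the differences of means are bounded by \<open>2 * C\<close>, so dominated
  convergence turns this into convergence in mean.\<close>

lemma conditional_L1_of_AE_convergence:
  assumes P: "prob_space P" and P': "prob_space P'" and P0: "prob_space P0"
    and Z [measurable]: "\<And>n. Z n \<in> measurable (P \<Otimes>\<^sub>M P') (ball_algebra m)"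
    and \<xi> [measurable]: "\<xi> \<in> measurable P0 (ball_algebra m)"
    and conv: "AE \<omega> in P. conv_in_distr_ball m (\<lambda>n. P') (\<lambda>n \<omega>'. Z n (\<omega>, \<omega>')) P0 \<xi>"
    and B: "B \<in> bl_functions m"
  shows "(\<lambda>n. \<integral>\<omega>. \<bar>(\<integral>\<omega>'. B (Z n (\<omega>, \<omega>')) \<partial>P') - (\<integral>t. B (\<xi> t) \<partial>P0)\<bar> \<partial>P) \<longlonglongrightarrow> 0"
proof -
  interpret P: prob_space P by fact
  interpret P': prob_space P' by fact
  interpret P0: prob_space P0 by fact
  note [measurable] = bl_functions_measurable[OF B]
  obtain C where C: "0 < C" "\<And>x. x \<in> mspace m \<Longrightarrow> \<bar>B x\<bar> \<le> C"
    by (rule bl_functionsE[OF B]) iprover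
  have sect: "(\<lambda>\<omega>'. Z n (\<omega>, \<omega>')) \<in> measurable P' (ball_algebra m)" if "\<omega> \<in> space P" for n \<omega>
    by (rule measurable_compose[OF measurable_Pair1'[OF that] Z])
  have bound: "\<bar>(\<integral>\<omega>'. B (Z n (\<omega>, \<omega>')) \<partial>P') - (\<integral>t. B (\<xi> t) \<partial>P0)\<bar> \<le> 2 * C"
    if "\<omega> \<in> space P" for n \<omega>
    by (rule bounded_integral_diff_le[OF P' sect[OF that] P0 \<xi> bl_functions_measurable[OF B] C(2)])
  have "(\<lambda>n. \<integral>\<omega>. \<bar>(\<integral>\<omega>'. B (Z n (\<omega>, \<omega>')) \<partial>P') - (\<integral>t. B (\<xi> t) \<partial>P0)\<bar> \<partial>P) \<longlonglongrightarrow> (\<integral>\<omega>. 0 \<partial>P)"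
  proof (rule integral_dominated_convergence[where w="\<lambda>_. 2 * C"])
    show "AE \<omega> in P. (\<lambda>n. \<bar>(\<integral>\<omega>'. B (Z n (\<omega>, \<omega>')) \<partial>P') - (\<integral>t. B (\<xi> t) \<partial>P0)\<bar>) \<longlonglongrightarrow> 0"
      using conv AE_space
    proof eventually_elim
      case (elim \<omega>)
      have "(\<lambda>n. \<integral>\<omega>'. B (Z n (\<omega>, \<omega>')) \<partial>P') \<longlonglongrightarrow> (\<integral>t. B (\<xi> t) \<partial>P0)"
        using elim(1) bl_functions_subset_Cb B
        unfolding conv_in_distr_ball_Cb_iff[of "\<lambda>n \<omega>'. Z n (\<omega>, \<omega>')" "\<lambda>n. P'", OF sect[OF elim(2)] \<xi>]
        by blast
      then show ?case by (simp add: LIM_zero tendsto_rabs_zero)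
    qed
    show "AE \<omega> in P. norm \<bar>(\<integral>\<omega>'. B (Z n (\<omega>, \<omega>')) \<partial>P') - (\<integral>t. B (\<xi> t) \<partial>P0)\<bar> \<le> 2 * C" for n
      using bound by (intro AE_I2) simp
    show "(\<lambda>\<omega>. \<bar>(\<integral>\<omega>'. B (Z n (\<omega>, \<omega>')) \<partial>P') - (\<integral>t. B (\<xi> t) \<partial>P0)\<bar>) \<in> borel_measurable P" for n
      by measurable
  qed simp_all
  then show ?thesis by simp
qed

text \<open>Every measurable cover of \<open>S\<close> also covers \<open>A\<close>, so the infimum
  cannot fall below the measure of \<open>A\<close>.\<close>

lemma outer_prob_ge_measure:
  assumes "prob_space P" "A \<in> sets P" "A \<subseteq> S" "S \<subseteq> space P"
  shows "measure P A \<le> outer_prob P S"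
proof -
  interpret prob_space P by fact
  show ?thesis unfolding outer_prob_def
  proof (rule cINF_greatest)
    show "{A \<in> sets P. S \<subseteq> A} \<noteq> {}" using assms(4) by auto
    show "measure P A \<le> measure P A'" if "A' \<in> {A \<in> sets P. S \<subseteq> A}" for A'
      using that assms(3) by (intro finite_measure_mono) auto
  qed
qed

text \<open>The conditional means of a single test function are measurable, so outer convergence of the
  (possibly nonmeasurable) distance turns into honest convergence for each of them.\<close>

lemma conditional_L1_of_outer_convergence:
  assumes P: "prob_space P" and P': "prob_space P'" and P0: "prob_space P0"
    and Z [measurable]: "\<And>n. Z n \<in> measurable (P \<Otimes>\<^sub>M P') (ball_algebra m)"
    and \<xi> [measurable]: "\<xi> \<in> measurable P0 (ball_algebra m)"
    and conv: "\<And>\<delta>. 0 < \<delta> \<Longrightarrow> (\<lambda>n. outer_prob P {\<omega> \<in> space P. \<delta> \<le> dist_BL_ball m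
        (distr P' (ball_algebra m) (\<lambda>\<omega>'. Z n (\<omega>, \<omega>'))) (distr P0 (ball_algebra m) \<xi>)}) \<longlonglongrightarrow> 0"
    and B: "B \<in> bl_functions m"
  shows "(\<lambda>n. \<integral>\<omega>. \<bar>(\<integral>\<omega>'. B (Z n (\<omega>, \<omega>')) \<partial>P') - (\<integral>t. B (\<xi> t) \<partial>P0)\<bar> \<partial>P) \<longlonglongrightarrow> 0"
proof -
  interpret P: prob_space P by fact
  interpret P': prob_space P' by fact
  interpret P0: prob_space P0 by fact
  note B_meas [measurable] = bl_functions_measurable[OF B]
  obtain C where C: "0 < C" "\<And>x. x \<in> mspace m \<Longrightarrow> \<bar>B x\<bar> \<le> C"
    "\<And>x y. x \<in> mspace m \<Longrightarrow> y \<in> mspace m \<Longrightarrow> \<bar>B x - B y\<bar> \<le> C * mdist m x y"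
    using bl_functionsE[OF B] by blast
  have sect: "(\<lambda>\<omega>'. Z n (\<omega>, \<omega>')) \<in> measurable P' (ball_algebra m)" if "\<omega> \<in> space P" for n \<omega>
    by (rule measurable_compose[OF measurable_Pair1'[OF that] Z])
  define h where "h n \<omega> = \<bar>(\<integral>\<omega>'. B (Z n (\<omega>, \<omega>')) \<partial>P') - (\<integral>t. B (\<xi> t) \<partial>P0)\<bar>" for n \<omega>
  have h_meas [measurable]: "h n \<in> borel_measurable P" for n
    unfolding h_def[abs_def] by measurable
  have h_bound: "h n \<omega> \<le> 2 * C" if "\<omega> \<in> space P" for n \<omega>
    unfolding h_def by (rule bounded_integral_diff_le[OF P' sect[OF that] P0 \<xi> B_meas C(2)])
  have h_nonneg: "0 \<le> h n \<omega>" for n \<omega> by (simp add: h_def)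
  have h_int: "integrable P (h n)" for n
    using h_bound h_nonneg by (intro P.bounded_integrable[of _ "2 * C"]) auto
  have "(\<lambda>n. \<integral>\<omega>. h n \<omega> \<partial>P) \<longlonglongrightarrow> 0"
  proof (rule LIMSEQ_I)
    fix \<eta> :: real assume \<eta>: "0 < \<eta>"
    \<comment> \<open>The mean is split at level \<open>\<delta>\<close>: off \<open>A n\<close> the
      error is below \<open>\<eta> / 2\<close>, and on \<open>A n\<close> it is at most
      \<open>2 * C\<close>, which leaves \<open>\<eta> / (4 * C)\<close> as the admissible
      probability. Scaling \<open>B\<close> by \<open>C\<close> turns the level into
      \<open>\<delta> / C\<close> for the distance.\<close>
    define \<delta> where "\<delta> = \<eta> / 2"
    have \<delta>: "0 < \<delta>" "0 < \<delta> / C" using \<eta> C(1) by (auto simp: \<delta>_def)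
    define S where "S n = {\<omega> \<in> space P. \<delta> / C \<le> dist_BL_ball m
        (distr P' (ball_algebra m) (\<lambda>\<omega>'. Z n (\<omega>, \<omega>'))) (distr P0 (ball_algebra m) \<xi>)}" for n
    define A where "A n = {\<omega> \<in> space P. \<delta> \<le> h n \<omega>}" for n
    have A_sets [measurable]: "A n \<in> sets P" for n unfolding A_def by measurable
    have "A n \<subseteq> S n" for n
    proof
      fix \<omega> assume "\<omega> \<in> A n"
      then have w: "\<omega> \<in> space P" "\<delta> \<le> h n \<omega>" by (auto simp: A_def)
      have "h n \<omega> \<le> C * dist_BL_ball m
        (distr P' (ball_algebra m) (\<lambda>\<omega>'. Z n (\<omega>, \<omega>'))) (distr P0 (ball_algebra m) \<xi>)"
        unfolding h_def by (rule bl_functions_diff_le_dist_BL[OF P' sect[OF w(1)] P0 \<xi> C B_meas])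
      then show "\<omega> \<in> S n" using w C(1) by (simp add: S_def divide_le_eq mult.commute)
    qed
    then have A_le: "measure P (A n) \<le> outer_prob P (S n)" for n
      by (intro outer_prob_ge_measure P A_sets) (auto simp: S_def)
    have "eventually (\<lambda>n. outer_prob P (S n) < \<eta> / (4 * C)) sequentially"
      using conv[OF \<delta>(2)] \<eta> C(1) unfolding S_def by (intro order_tendstoD(2)) auto
    then obtain N where N: "\<And>n. N \<le> n \<Longrightarrow> outer_prob P (S n) < \<eta> / (4 * C)"
      unfolding eventually_sequentially by blast
    have "norm ((\<integral>\<omega>. h n \<omega> \<partial>P) - 0) < \<eta>" if n: "N \<le> n" for n
    proof -
      have "(\<integral>\<omega>. h n \<omega> \<partial>P) \<le> (\<integral>\<omega>. \<delta> + 2 * C * indicator (A n) \<omega> \<partial>P)"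
      proof (rule integral_mono)
        show "integrable P (\<lambda>\<omega>. \<delta> + 2 * C * indicator (A n) \<omega>)"
          using C(1) \<delta>(1)
          by (intro P.bounded_integrable[of _ "\<delta> + 2 * C"]) (auto simp: indicator_def)
        show "h n \<omega> \<le> \<delta> + 2 * C * indicator (A n) \<omega>" if "\<omega> \<in> space P" for \<omega>
          using h_bound[OF that, of n] that \<delta>(1) by (auto simp: A_def indicator_def)
      qed (rule h_int)
      also have "\<dots> = \<delta> + 2 * C * measure P (A n)" 
        by (simp add: P.prob_space P.emeasure_eq_measure Int_absorb2 sets.sets_into_space)
      also have "\<dots> < \<delta> + 2 * C * (\<eta> / (4 * C))"
        using A_le[of n] N[OF n] C(1) by (intro add_strict_left_mono mult_strict_left_mono) auto
      also have "\<dots> = \<eta>" using C(1) by (simp add: \<delta>_def)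
      finally have "(\<integral>\<omega>. h n \<omega> \<partial>P) < \<eta>" .
      moreover have "0 \<le> (\<integral>\<omega>. h n \<omega> \<partial>P)" by (simp add: h_nonneg)
      ultimately show ?thesis by simp
    qed
    then show "\<exists>no. \<forall>n\<ge>no. norm ((\<integral>\<omega>. h n \<omega> \<partial>P) - 0) < \<eta>" by blast
  qed
  then show ?thesis unfolding h_def .
qed

section \<open>The delta method\<close>

text \<open>If uniformity failed, violating points \<open>x k\<close> with indices
  \<open>n k \<ge> k\<close> would form an admissible triplet with steps
  \<open>inverse (a (n k))\<close>. The derivative is defined through arbitrary null sequences of
  steps, so repeated or unordered indices do no harm, and \<open>n k \<ge> k\<close> alone forces
  the steps to 0.\<close>

lemma quasi_hadamard_locally_uniform:
  assumes qh: "has_quasi_hadamard_derivative f Vf E nE E0 \<theta> D"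
    and y: "y \<in> E0" and e: "0 < e" and nonneg: "\<And>x. x \<in> E \<Longrightarrow> 0 \<le> nE (x - y)"
    and a: "\<And>n. 0 < a n" "filterlim a at_top sequentially"
  shows "\<exists>r>0. \<exists>N. \<forall>n\<ge>N. \<forall>x\<in>E. nE (x - y) < r \<longrightarrow> \<theta> + inverse (a n) *\<^sub>R x \<in> Vf \<longrightarrow>
    norm (a n *\<^sub>R (f (\<theta> + inverse (a n) *\<^sub>R x) - f \<theta>) - D y) < e"
proof (rule ccontr)
  assume neg: "\<not> ?thesis"
  have "\<exists>n x. k \<le> n \<and> x \<in> E \<and> nE (x - y) < 1 / real (Suc k) \<and> \<theta> + inverse (a n) *\<^sub>R x \<in> Vf
      \<and> e \<le> norm (a n *\<^sub>R (f (\<theta> + inverse (a n) *\<^sub>R x) - f \<theta>) - D y)" for k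
  proof -
    have "0 < 1 / real (Suc k)" by simp
    with neg show ?thesis by (meson not_less)
  qed
  then obtain n x where nx: "\<And>k. k \<le> n k" "\<And>k. x k \<in> E" "\<And>k. nE (x k - y) < 1 / real (Suc k)"
    "\<And>k. \<theta> + inverse (a (n k)) *\<^sub>R x k \<in> Vf"
    "\<And>k. e \<le> norm (a (n k) *\<^sub>R (f (\<theta> + inverse (a (n k)) *\<^sub>R x k) - f \<theta>) - D y)"
    by metis
  have "filterlim n at_top sequentially"
    by (rule filterlim_at_top_mono[OF filterlim_ident]) (simp add: nx(1))
  then have "filterlim (\<lambda>k. a (n k)) at_top sequentially"
    by (rule filterlim_compose[OF a(2)])
  then have \<epsilon>_lim: "(\<lambda>k. inverse (a (n k))) \<longlonglongrightarrow> 0"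
    by (rule tendsto_inverse_0_at_top)
  have x_lim: "(\<lambda>k. nE (x k - y)) \<longlonglongrightarrow> 0"
    by (rule tendsto_sandwich[OF _ _ tendsto_const lim_1_over_n[THEN LIMSEQ_Suc]])
      (auto intro!: always_eventually less_imp_le nx(3) nonneg nx(2) simp del: of_nat_Suc)
  have "(\<lambda>k. norm (D y - inverse (inverse (a (n k))) *\<^sub>R
      (f (\<theta> + inverse (a (n k)) *\<^sub>R x k) - f \<theta>))) \<longlonglongrightarrow> 0"
    using y nx(2,4) x_lim \<epsilon>_lim a(1)
    by (intro qh[unfolded has_quasi_hadamard_derivative_def, THEN conjunct2, rule_format] conjI allI) auto
  then have "(\<lambda>k. norm (a (n k) *\<^sub>R (f (\<theta> + inverse (a (n k)) *\<^sub>R x k) - f \<theta>) - D y)) \<longlonglongrightarrow> 0"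
    by (simp add: norm_minus_commute)
  from LIMSEQ_le_const[OF this, of e] nx(5) e show False by auto
qed

theorem theorem3p1:
  fixes E E0 Vf :: "'v::real_vector set"
    and nE :: "'v \<Rightarrow> real"
    and P :: "'w measure" and P' :: "'w' measure" and P0 :: "'z measure"
    and f :: "'v \<Rightarrow> 'e::{real_normed_vector, second_countable_topology}"
    and T :: "nat \<Rightarrow> 'w \<Rightarrow> 'v"
    and Ts :: "nat \<Rightarrow> 'w \<times> 'w' \<Rightarrow> 'v"
    and \<theta> :: 'v
    and a :: "nat \<Rightarrow> real"
    and \<xi> :: "'z \<Rightarrow> 'v"
    and D :: "'v \<Rightarrow> 'e"
  assumes "normed_subspace E nE"
    and "prob_space P" and "prob_space P'" and "prob_space P0"
    and "\<And>n \<omega>. \<omega> \<in> space P \<Longrightarrow> T n \<omega> \<in> Vf"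
    and "\<And>n \<omega>. \<omega> \<in> space (P \<Otimes>\<^sub>M P') \<Longrightarrow> Ts n \<omega> \<in> Vf"
    and "\<theta> \<in> Vf"
    and "subspace E0" and "E0 \<subseteq> E"
    and "separable_space (subtopology (mtopology_of (norm_metric E nE)) E0)"
    and "E0 \<in> sets (ball_algebra (norm_metric E nE))"
    and "\<And>n. 0 < a n" and "filterlim a at_top sequentially"
  shows
   "let m = norm_metric E nE;
        B = ball_algebra m;
        cond_a =
          ((\<forall>n. \<forall>\<omega>\<in>space P. a n *\<^sub>R (T n \<omega> - \<theta>) \<in> E) \<and>
           (\<forall>n. (\<lambda>\<omega>. a n *\<^sub>R (T n \<omega> - \<theta>)) \<in> measurable P B) \<and>
           \<xi> \<in> measurable P0 B \<and> \<xi> ` space P0 \<subseteq> E0 \<and>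
           conv_in_distr_ball m (\<lambda>n. P) (\<lambda>n \<omega>. a n *\<^sub>R (T n \<omega> - \<theta>)) P0 \<xi>);
        cond_b = (\<forall>n. (\<lambda>\<omega>. f (T n \<omega>)) \<in> measurable P borel);
        cond_c = has_quasi_hadamard_derivative f Vf E nE E0 \<theta> D;
        cond_d =
          (\<exists>F. (\<forall>x\<in>E0. F x = D x) \<and>
               (\<forall>x\<in>E. \<forall>y\<in>E. F (x + y) = F x + F y) \<and>
               (\<forall>x\<in>E. \<forall>c. F (c *\<^sub>R x) = c *\<^sub>R F x) \<and>
               F \<in> measurable B borel \<and>
               (\<forall>x\<in>E0. topcontinuous_at (mtopology_of m) euclidean F x));
        cond_e = (\<forall>n. (\<lambda>\<omega>. f (Ts n \<omega>)) \<in> measurable (P \<Otimes>\<^sub>M P') borel);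
        cond_f_meas =
          (\<forall>n. (\<forall>\<omega>\<in>space (P \<Otimes>\<^sub>M P'). a n *\<^sub>R (Ts n \<omega> - \<theta>) \<in> E
                                      \<and> a n *\<^sub>R (Ts n \<omega> - T n (fst \<omega>)) \<in> E) \<and>
               (\<lambda>\<omega>. a n *\<^sub>R (Ts n \<omega> - \<theta>)) \<in> measurable (P \<Otimes>\<^sub>M P') B \<and>
               (\<lambda>\<omega>. a n *\<^sub>R (Ts n \<omega> - T n (fst \<omega>))) \<in> measurable (P \<Otimes>\<^sub>M P') B);
        cond_f =
          (cond_f_meas \<and>
           (AE \<omega> in P. conv_in_distr_ball m (\<lambda>n. P')
                         (\<lambda>n \<omega>'. a n *\<^sub>R (Ts n (\<omega>, \<omega>') - T n \<omega>)) P0 \<xi>));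
        Pn = (\<lambda>n \<omega>. distr P' B (\<lambda>\<omega>'. a n *\<^sub>R (Ts n (\<omega>, \<omega>') - T n \<omega>)));
        cond_f' =
          (cond_f_meas \<and>
           (\<forall>\<delta>>0. (\<lambda>n. outer_prob P
              {\<omega> \<in> space P. dist_BL_ball m (Pn n \<omega>) (distr P0 B \<xi>) \<ge> \<delta>}) \<longlonglongrightarrow> 0));
        concl_i =
          ((\<forall>n. (\<lambda>\<omega>. a n *\<^sub>R (f (T n \<omega>) - f \<theta>)) \<in> measurable P borel) \<and>
           (\<lambda>z. D (\<xi> z)) \<in> measurable P0 borel \<and>
           conv_in_distr_ball euclidean_metric (\<lambda>n. P)
             (\<lambda>n \<omega>. a n *\<^sub>R (f (T n \<omega>) - f \<theta>)) P0 (\<lambda>z. D (\<xi> z)));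
        Pn' = (\<lambda>n \<omega>. distr P' borel (\<lambda>\<omega>'. a n *\<^sub>R (f (Ts n (\<omega>, \<omega>')) - f (T n \<omega>))));
        bad = (\<lambda>n \<delta>. {\<omega> \<in> space P.
                 dist_BL_ball euclidean_metric (Pn' n \<omega>) (distr P0 borel (\<lambda>z. D (\<xi> z))) \<ge> \<delta>});
        concl_ii =
          ((\<forall>n. (\<lambda>\<omega>. a n *\<^sub>R (f (Ts n \<omega>) - f (T n (fst \<omega>)))) \<in> measurable (P \<Otimes>\<^sub>M P') borel) \<and>
           (\<lambda>z. D (\<xi> z)) \<in> measurable P0 borel \<and>
           (\<forall>\<delta>>0. (\<forall>n. bad n \<delta> \<in> sets P) \<and> (\<lambda>n. measure P (bad n \<delta>)) \<longlonglongrightarrow> 0))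
    in (cond_a \<and> cond_b \<and> cond_c \<longrightarrow> concl_i) \<and>
       (cond_a \<and> cond_b \<and> cond_c \<and> cond_d \<and> cond_e \<and> cond_f \<longrightarrow> concl_ii) \<and>
       (cond_a \<and> cond_b \<and> cond_c \<and> cond_d \<and> cond_e \<and> cond_f' \<longrightarrow> concl_ii)"
proof -
  define m where "m = norm_metric E nE"
  define B where "B = ball_algebra m"
  have E: "subspace E" "\<And>x. x \<in> E \<Longrightarrow> 0 \<le> nE x"
    using assms(1) unfolding normed_subspace_def by auto
  have mspace: "mspace m = E"
    unfolding m_def by (rule mspace_norm_metric[OF assms(1)])
  have sub: "E0 \<subseteq> mspace m" unfolding mspace by (rule assms(9))
  have mdist: "mdist m x y = nE (y - x)" if "x \<in> E" "y \<in> E" for x y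
    using mdist_norm_metric[OF assms(1) that(2,1)] mdist_commute[of m x y] by (simp add: m_def)
  have sep: "separable_space (subtopology (mtopology_of m) E0)"
    using assms(10) by (simp add: m_def)
  have loc: "\<exists>r>0. \<exists>N. \<forall>n\<ge>N. \<forall>x\<in>E. mdist m y x < r \<longrightarrow> \<theta> + inverse (a n) *\<^sub>R x \<in> Vf \<longrightarrow>
      norm (a n *\<^sub>R (f (\<theta> + inverse (a n) *\<^sub>R x) - f \<theta>) - D y) < e"
    if "has_quasi_hadamard_derivative f Vf E nE E0 \<theta> D" "y \<in> E0" "0 < e" for y e
  proof -
    have y: "y \<in> E" using that(2) assms(9) by auto
    have "0 \<le> nE (x - y)" if "x \<in> E" for x
      using E(2) subspace_diff[OF E(1) that y] .
    from quasi_hadamard_locally_uniform[OF that this assms(12,13)]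
    show ?thesis using mdist[OF y] by simp
  qed
  \<comment> \<open>The local estimate at \<open>x = a n *\<^sub>R (v - \<theta>)\<close> thereby
    becomes a statement about \<open>f v\<close>, with \<open>v\<close> the estimator or its
    bootstrap version.\<close>
  have rescale: "\<theta> + inverse (a n) *\<^sub>R (a n *\<^sub>R (v - \<theta>)) = v" for n v
    using assms(12)[of n] by simp

  have part_i: "(\<forall>n. (\<lambda>\<omega>. a n *\<^sub>R (f (T n \<omega>) - f \<theta>)) \<in> measurable P borel) \<and>
      (\<lambda>z. D (\<xi> z)) \<in> measurable P0 borel \<and>
      conv_in_distr_ball euclidean_metric (\<lambda>n. P)
        (\<lambda>n \<omega>. a n *\<^sub>R (f (T n \<omega>) - f \<theta>)) P0 (\<lambda>z. D (\<xi> z))"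
    if XE: "\<And>n \<omega>. \<omega> \<in> space P \<Longrightarrow> a n *\<^sub>R (T n \<omega> - \<theta>) \<in> E"
      and X: "\<And>n. (\<lambda>\<omega>. a n *\<^sub>R (T n \<omega> - \<theta>)) \<in> measurable P B"
      and \<xi>: "\<xi> \<in> measurable P0 B" and \<xi>E0: "\<xi> ` space P0 \<subseteq> E0"
      and conv: "conv_in_distr_ball m (\<lambda>n. P) (\<lambda>n \<omega>. a n *\<^sub>R (T n \<omega> - \<theta>)) P0 \<xi>"
      and fT [measurable]: "\<And>n. (\<lambda>\<omega>. f (T n \<omega>)) \<in> measurable P borel"
      and qh: "has_quasi_hadamard_derivative f Vf E nE E0 \<theta> D"
  proof (intro conjI allI)
    have D: "continuous_map (subtopology (mtopology_of m) E0) euclidean D"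
      using qh by (simp add: has_quasi_hadamard_derivative_def m_def)
    have \<xi>_in: "\<xi> t \<in> E0" if "t \<in> space P0" for t using \<xi>E0 that by blast
    show Y: "(\<lambda>\<omega>. a n *\<^sub>R (f (T n \<omega>) - f \<theta>)) \<in> measurable P borel" for n
      by measurable
    show "(\<lambda>z. D (\<xi> z)) \<in> measurable P0 borel"
      by (rule continuous_on_separable_measurable[OF sep sub \<xi>[unfolded B_def] \<xi>_in
            continuous_map_metric_localD[OF D sub]])
    show "conv_in_distr_ball euclidean_metric (\<lambda>n. P)
        (\<lambda>n \<omega>. a n *\<^sub>R (f (T n \<omega>) - f \<theta>)) P0 (\<lambda>z. D (\<xi> z))"
    proof (rule extended_continuous_mapping[OF assms(2,4) X[unfolded B_def] \<xi>[unfolded B_def] conv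
          sep sub \<xi>_in Y D])
      fix z e assume "z \<in> E0" "0 < (e::real)"
      from loc[OF qh this] obtain r N where r: "0 < r" "\<forall>n\<ge>N. \<forall>x\<in>E. mdist m z x < r \<longrightarrow>
          \<theta> + inverse (a n) *\<^sub>R x \<in> Vf \<longrightarrow>
          norm (a n *\<^sub>R (f (\<theta> + inverse (a n) *\<^sub>R x) - f \<theta>) - D z) < e" by blast
      have "dist (a n *\<^sub>R (f (T n \<omega>) - f \<theta>)) (D z) < e"
        if "N \<le> n" "\<omega> \<in> space P" "mdist m z (a n *\<^sub>R (T n \<omega> - \<theta>)) < r" for n \<omega>
        using r(2)[rule_format, OF that(1) XE[OF that(2)] that(3), unfolded rescale] assms(5)[OF that(2)]
        by (simp add: dist_norm)
      then show "\<exists>r>0. \<exists>N. \<forall>n\<ge>N. \<forall>\<omega>\<in>space P. mdist m z (a n *\<^sub>R (T n \<omega> - \<theta>)) < r \<longrightarrow>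
          dist (a n *\<^sub>R (f (T n \<omega>) - f \<theta>)) (D z) < e"
        using r(1) by blast
    qed
  qed

  \<comment> \<open>The bootstrap enters only through mean convergence for single test functions, so
    this one statement serves both modes.\<close>
  have part_ii: "(\<forall>n. (\<lambda>\<omega>. a n *\<^sub>R (f (Ts n \<omega>) - f (T n (fst \<omega>)))) \<in> measurable (P \<Otimes>\<^sub>M P') borel) \<and>
      (\<lambda>z. D (\<xi> z)) \<in> measurable P0 borel \<and>
      (\<forall>\<delta>>0. (\<forall>n. {\<omega> \<in> space P. dist_BL_ball euclidean_metric
            (distr P' borel (\<lambda>\<omega>'. a n *\<^sub>R (f (Ts n (\<omega>, \<omega>')) - f (T n \<omega>))))
            (distr P0 borel (\<lambda>z. D (\<xi> z))) \<ge> \<delta>} \<in> sets P) \<and>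
         (\<lambda>n. measure P {\<omega> \<in> space P. dist_BL_ball euclidean_metric
            (distr P' borel (\<lambda>\<omega>'. a n *\<^sub>R (f (Ts n (\<omega>, \<omega>')) - f (T n \<omega>))))
            (distr P0 borel (\<lambda>z. D (\<xi> z))) \<ge> \<delta>}) \<longlonglongrightarrow> 0)"
    if XE: "\<And>n \<omega>. \<omega> \<in> space P \<Longrightarrow> a n *\<^sub>R (T n \<omega> - \<theta>) \<in> E"
      and X: "\<And>n. (\<lambda>\<omega>. a n *\<^sub>R (T n \<omega> - \<theta>)) \<in> measurable P B"
      and \<xi>: "\<xi> \<in> measurable P0 B" and \<xi>E0: "\<xi> ` space P0 \<subseteq> E0"
      and conv: "conv_in_distr_ball m (\<lambda>n. P) (\<lambda>n \<omega>. a n *\<^sub>R (T n \<omega> - \<theta>)) P0 \<xi>"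
      and fT [measurable]: "\<And>n. (\<lambda>\<omega>. f (T n \<omega>)) \<in> measurable P borel"
      and qh: "has_quasi_hadamard_derivative f Vf E nE E0 \<theta> D"
      and add: "\<And>y z. y \<in> E0 \<Longrightarrow> z \<in> E0 \<Longrightarrow> D (y + z) = D y + D z"
      and fTs [measurable]: "\<And>n. (\<lambda>\<omega>. f (Ts n \<omega>)) \<in> measurable (P \<Otimes>\<^sub>M P') borel"
      and ZE: "\<And>n \<omega>. \<omega> \<in> space (P \<Otimes>\<^sub>M P') \<Longrightarrow> a n *\<^sub>R (Ts n \<omega> - T n (fst \<omega>)) \<in> E"
      and Z: "\<And>n. (\<lambda>\<omega>. a n *\<^sub>R (Ts n \<omega> - T n (fst \<omega>))) \<in> measurable (P \<Otimes>\<^sub>M P') B"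
      and Z_lim: "\<And>A. A \<in> bl_functions m \<Longrightarrow> (\<lambda>n. \<integral>\<omega>. \<bar>(\<integral>\<omega>'. A (a n *\<^sub>R (Ts n (\<omega>, \<omega>') - T n (fst (\<omega>, \<omega>')))) \<partial>P')
          - (\<integral>t. A (\<xi> t) \<partial>P0)\<bar> \<partial>P) \<longlonglongrightarrow> 0"
  proof -
    have D: "continuous_map (subtopology (mtopology_of m) E0) euclidean D"
      using qh by (simp add: has_quasi_hadamard_derivative_def m_def)
    have \<xi>_in: "\<xi> t \<in> E0" if "t \<in> space P0" for t using \<xi>E0 that by blast
    have X_lim: "(\<lambda>n. \<integral>\<omega>. A (a n *\<^sub>R (T n \<omega> - \<theta>)) \<partial>P) \<longlonglongrightarrow> (\<integral>t. A (\<xi> t) \<partial>P0)"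
      if "A \<in> bl_functions m" for A
      using conv bl_functions_subset_Cb that
      unfolding conv_in_distr_ball_Cb_iff[of "\<lambda>n \<omega>. a n *\<^sub>R (T n \<omega> - \<theta>)" "\<lambda>n. P",
          OF X[unfolded B_def] \<xi>[unfolded B_def]] by blast
    interpret cbl: conditional_bl_convergence P P' P0 P0 m "\<lambda>n \<omega>. a n *\<^sub>R (T n \<omega> - \<theta>)"
        "\<lambda>n \<omega>. a n *\<^sub>R (Ts n \<omega> - T n (fst \<omega>))" \<xi> \<xi>
      by (intro conditional_bl_convergence.intro conditional_bl_convergence_axioms.intro)
        ((rule assms(2,3,4) X[unfolded B_def] Z[unfolded B_def] \<xi>[unfolded B_def]) | (erule Z_lim) | (erule X_lim))+
    have Y: "(\<lambda>\<omega>. a n *\<^sub>R (f (Ts n \<omega>) - f (T n (fst \<omega>)))) \<in> measurable (P \<Otimes>\<^sub>M P') borel" for n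
      by measurable
    \<comment> \<open>The derivative estimate is used at \<open>y\<close> for the estimator and at
      \<open>y + z\<close> for the bootstrap version. Subtracting the two leaves
      \<open>D (y + z) - D y\<close>, which additivity identifies with \<open>D z\<close>.\<close>
    have local: "\<exists>r>0. \<exists>N. \<forall>n\<ge>N. \<forall>\<omega>\<in>space P. \<forall>\<omega>'\<in>space P'. mdist m y (a n *\<^sub>R (T n \<omega> - \<theta>)) < r \<longrightarrow>
        mdist m z (a n *\<^sub>R (Ts n (\<omega>, \<omega>') - T n (fst (\<omega>, \<omega>')))) < r \<longrightarrow>
        dist (a n *\<^sub>R (f (Ts n (\<omega>, \<omega>')) - f (T n (fst (\<omega>, \<omega>'))))) (D z) < e"
      if y: "y \<in> E0" and z: "z \<in> E0" and e: "0 < e" for y z e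
    proof -
      have yz: "y + z \<in> E0" using assms(8) y z by (rule subspace_add)
      have inE: "y \<in> E" "z \<in> E" "y + z \<in> E" using y z yz assms(9) by auto
      have e2: "0 < e / 2" using e by simp
      from loc[OF qh y e2] obtain r1 N1 where 1: "0 < r1" "\<forall>n\<ge>N1. \<forall>x\<in>E. mdist m y x < r1 \<longrightarrow>
          \<theta> + inverse (a n) *\<^sub>R x \<in> Vf \<longrightarrow>
          norm (a n *\<^sub>R (f (\<theta> + inverse (a n) *\<^sub>R x) - f \<theta>) - D y) < e / 2" by blast
      from loc[OF qh yz e2] obtain r2 N2 where 2: "0 < r2" "\<forall>n\<ge>N2. \<forall>x\<in>E. mdist m (y + z) x < r2 \<longrightarrow>
          \<theta> + inverse (a n) *\<^sub>R x \<in> Vf \<longrightarrow>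
          norm (a n *\<^sub>R (f (\<theta> + inverse (a n) *\<^sub>R x) - f \<theta>) - D (y + z)) < e / 2" by blast
      \<comment> \<open>The halving is needed because the distances to \<open>y\<close> and to
        \<open>z\<close> add up in the distance of the sum to \<open>y + z\<close>.\<close>
      define r where "r = min r1 (r2 / 2)"
      have r: "0 < r" "r \<le> r1" "r + r \<le> r2" using 1(1) 2(1) by (auto simp: r_def)
      have "dist (a n *\<^sub>R (f (Ts n (\<omega>, \<omega>')) - f (T n \<omega>))) (D z) < e"
        if n: "max N1 N2 \<le> n" and w: "\<omega> \<in> space P" and w': "\<omega>' \<in> space P'"
          and near: "mdist m y (a n *\<^sub>R (T n \<omega> - \<theta>)) < r" "mdist m z (a n *\<^sub>R (Ts n (\<omega>, \<omega>') - T n \<omega>)) < r"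
        for n \<omega> \<omega>'
      proof -
        have ww: "(\<omega>, \<omega>') \<in> space (P \<Otimes>\<^sub>M P')" using w w' by (simp add: space_pair_measure)
        define x where "x = a n *\<^sub>R (T n \<omega> - \<theta>)"
        define x' where "x' = a n *\<^sub>R (Ts n (\<omega>, \<omega>') - T n \<omega>)"
        have x: "x \<in> E" unfolding x_def by (rule XE[OF w])
        have x': "x' \<in> E" unfolding x'_def using ZE[OF ww, of n] by simp
        have sum: "x + x' = a n *\<^sub>R (Ts n (\<omega>, \<omega>') - \<theta>)" unfolding x_def x'_def by (simp add: algebra_simps)
        have xx': "x + x' \<in> E" by (rule subspace_add[OF E(1) x x'])
        have "nE ((x + x') - (y + z)) \<le> nE (x - y) + nE (x' - z)"
        proof -
          have "nE ((x - y) + (x' - z)) \<le> nE (x - y) + nE (x' - z)"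
            using assms(1) subspace_diff[OF E(1) x inE(1)] subspace_diff[OF E(1) x' inE(2)]
            unfolding normed_subspace_def by blast
          then show ?thesis by (simp add: algebra_simps)
        qed
        then have near2: "mdist m (y + z) (x + x') < r2"
          using near r(3) unfolding x_def[symmetric] x'_def[symmetric]
            mdist[OF inE(1) x] mdist[OF inE(2) x'] mdist[OF inE(3) xx'] by linarith
        have b1: "norm (a n *\<^sub>R (f (T n \<omega>) - f \<theta>) - D y) < e / 2"
          using 1(2)[rule_format, of n x] n x near(1) r(2) assms(5)[OF w, of n]
          unfolding x_def rescale by simp
        have b2: "norm (a n *\<^sub>R (f (Ts n (\<omega>, \<omega>')) - f \<theta>) - D (y + z)) < e / 2"
          using 2(2)[rule_format, of n "x + x'"] n xx' near2 assms(6)[OF ww, of n]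
          unfolding sum rescale by simp
        have "a n *\<^sub>R (f (Ts n (\<omega>, \<omega>')) - f (T n \<omega>)) - D z
            = (a n *\<^sub>R (f (Ts n (\<omega>, \<omega>')) - f \<theta>) - D (y + z)) - (a n *\<^sub>R (f (T n \<omega>) - f \<theta>) - D y)"
          by (simp add: add[OF y z] algebra_simps)
        then have "norm (a n *\<^sub>R (f (Ts n (\<omega>, \<omega>')) - f (T n \<omega>)) - D z)
            \<le> norm (a n *\<^sub>R (f (Ts n (\<omega>, \<omega>')) - f \<theta>) - D (y + z)) + norm (a n *\<^sub>R (f (T n \<omega>) - f \<theta>) - D y)"
          by (metis norm_triangle_ineq4)
        then show ?thesis using b1 b2 by (simp add: dist_norm)
      qed
      then show ?thesis
        using r(1) by (intro exI[of _ r] conjI exI[of _ "max N1 N2"]) auto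
    qed
    note main = cbl.dist_BL_tendsto_in_probability[where K=D and
      Y="\<lambda>n \<omega>. a n *\<^sub>R (f (Ts n \<omega>) - f (T n (fst \<omega>)))", OF Y sep sub \<xi>_in \<xi>_in
      continuous_map_metric_localD[OF D sub] local]
    have "(\<lambda>z. D (\<xi> z)) \<in> measurable P0 borel"
      by (rule continuous_on_separable_measurable[OF sep sub \<xi>[unfolded B_def] \<xi>_in
            continuous_map_metric_localD[OF D sub]])
    then show ?thesis using main Y by simp
  qed

  define F_ext where "F_ext \<longleftrightarrow> (\<exists>F. (\<forall>x\<in>E0. F x = D x) \<and>
      (\<forall>x\<in>E. \<forall>y\<in>E. F (x + y) = F x + F y) \<and> (\<forall>x\<in>E. \<forall>c. F (c *\<^sub>R x) = c *\<^sub>R F x) \<and>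
      F \<in> measurable B borel \<and> (\<forall>x\<in>E0. topcontinuous_at (mtopology_of m) euclidean F x))"
  \<comment> \<open>\<open>E0\<close> is closed under addition, so the extension agrees with
    \<open>D\<close> at all three points and passes its additivity on.\<close>
  have add: "D (y + z) = D y + D z" if F_ext "y \<in> E0" "z \<in> E0" for y z
  proof -
    obtain F where F: "\<forall>x\<in>E0. F x = D x" "\<forall>x\<in>E. \<forall>y\<in>E. F (x + y) = F x + F y"
      using \<open>F_ext\<close> unfolding F_ext_def by blast
    then show ?thesis
      using that(2,3) assms(9) subspace_add[OF assms(8) that(2,3)] by (metis subsetD)
  qed
  show ?thesis
    unfolding Let_def m_def[symmetric] B_def[symmetric] F_ext_def[symmetric]
  proof (rule conjI[OF _ conjI]; rule impI, elim conjE)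
    assume "\<forall>n. \<forall>\<omega>\<in>space P. a n *\<^sub>R (T n \<omega> - \<theta>) \<in> E"
      "\<forall>n. (\<lambda>\<omega>. a n *\<^sub>R (T n \<omega> - \<theta>)) \<in> measurable P B"
      "\<xi> \<in> measurable P0 B" "\<xi> ` space P0 \<subseteq> E0"
      "conv_in_distr_ball m (\<lambda>n. P) (\<lambda>n \<omega>. a n *\<^sub>R (T n \<omega> - \<theta>)) P0 \<xi>"
      "\<forall>n. (\<lambda>\<omega>. f (T n \<omega>)) \<in> measurable P borel"
      "has_quasi_hadamard_derivative f Vf E nE E0 \<theta> D"
    note a_to_c = this
    show "(\<forall>n. (\<lambda>\<omega>. a n *\<^sub>R (f (T n \<omega>) - f \<theta>)) \<in> measurable P borel) \<and>
      (\<lambda>z. D (\<xi> z)) \<in> measurable P0 borel \<and>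
      conv_in_distr_ball euclidean_metric (\<lambda>n. P)
        (\<lambda>n \<omega>. a n *\<^sub>R (f (T n \<omega>) - f \<theta>)) P0 (\<lambda>z. D (\<xi> z))"
      by (rule part_i) (use a_to_c in blast)+
    assume F_ext
      "\<forall>n. (\<lambda>\<omega>. f (Ts n \<omega>)) \<in> measurable (P \<Otimes>\<^sub>M P') borel"
      "\<forall>n. (\<forall>\<omega>\<in>space (P \<Otimes>\<^sub>M P'). a n *\<^sub>R (Ts n \<omega> - \<theta>) \<in> E \<and> a n *\<^sub>R (Ts n \<omega> - T n (fst \<omega>)) \<in> E) \<and>
           (\<lambda>\<omega>. a n *\<^sub>R (Ts n \<omega> - \<theta>)) \<in> measurable (P \<Otimes>\<^sub>M P') B \<and>
           (\<lambda>\<omega>. a n *\<^sub>R (Ts n \<omega> - T n (fst \<omega>))) \<in> measurable (P \<Otimes>\<^sub>M P') B"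
    note d_to_f = this
    have Z: "(\<lambda>\<omega>. a n *\<^sub>R (Ts n \<omega> - T n (fst \<omega>))) \<in> measurable (P \<Otimes>\<^sub>M P') (ball_algebra m)" for n
      using d_to_f(3) unfolding B_def by blast
    have \<xi>: "\<xi> \<in> measurable P0 (ball_algebra m)" using a_to_c(3) unfolding B_def .
    let ?concl = "(\<forall>n. (\<lambda>\<omega>. a n *\<^sub>R (f (Ts n \<omega>) - f (T n (fst \<omega>)))) \<in> measurable (P \<Otimes>\<^sub>M P') borel) \<and>
      (\<lambda>z. D (\<xi> z)) \<in> measurable P0 borel \<and>
      (\<forall>\<delta>>0. (\<forall>n. {\<omega> \<in> space P. dist_BL_ball euclidean_metric
            (distr P' borel (\<lambda>\<omega>'. a n *\<^sub>R (f (Ts n (\<omega>, \<omega>')) - f (T n \<omega>))))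
            (distr P0 borel (\<lambda>z. D (\<xi> z))) \<ge> \<delta>} \<in> sets P) \<and>
         (\<lambda>n. measure P {\<omega> \<in> space P. dist_BL_ball euclidean_metric
            (distr P' borel (\<lambda>\<omega>'. a n *\<^sub>R (f (Ts n (\<omega>, \<omega>')) - f (T n \<omega>))))
            (distr P0 borel (\<lambda>z. D (\<xi> z))) \<ge> \<delta>}) \<longlonglongrightarrow> 0)"
    have concl: ?concl
      if "\<And>A. A \<in> bl_functions m \<Longrightarrow> (\<lambda>n. \<integral>\<omega>. \<bar>(\<integral>\<omega>'. A (a n *\<^sub>R (Ts n (\<omega>, \<omega>') - T n (fst (\<omega>, \<omega>')))) \<partial>P')
          - (\<integral>t. A (\<xi> t) \<partial>P0)\<bar> \<partial>P) \<longlonglongrightarrow> 0"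
      by (rule part_ii; (rule that add[OF d_to_f(1)])?) (use a_to_c d_to_f in blast)+
    show ?concl
      if "AE \<omega> in P. conv_in_distr_ball m (\<lambda>n. P') (\<lambda>n \<omega>'. a n *\<^sub>R (Ts n (\<omega>, \<omega>') - T n \<omega>)) P0 \<xi>"
      by (rule concl, rule conditional_L1_of_AE_convergence[OF assms(2,3,4) Z \<xi>]) (simp_all add: that)
    show ?concl
      if "\<forall>\<delta>>0. (\<lambda>n. outer_prob P {\<omega> \<in> space P. dist_BL_ball m
          (distr P' B (\<lambda>\<omega>'. a n *\<^sub>R (Ts n (\<omega>, \<omega>') - T n \<omega>))) (distr P0 B \<xi>) \<ge> \<delta>}) \<longlonglongrightarrow> 0"
      by (rule concl, rule conditional_L1_of_outer_convergence[OF assms(2,3,4) Z \<xi>])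
        (simp_all add: that[unfolded B_def])
  qed
qed

end
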